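(* Let $T>0$, let $r,\mu,\sigma:[0,T]\to\mathbb{R}$ be deterministic continuous functions with $\sigma_s>0$ for all $s\in[0,T]$, and let $B$ be a standard Brownian motion on a probability space $(\Omega,\mathcal{F},\mathbb{P})$. For $t\in(0,T)$ let $\left.\frac{M_t}{M_0}\right|_{\text{Honest}}$ and $\left.\frac{M_t}{M_0}\right|_{\text{Insider}}$ denote the normalized wealths at time $t$ of the honest trader, who uses the portfolio $\pi_s=\frac{\mu_s-r_s}{\sigma_s^2}$, and of the insider, who knows $B_T$ and uses the portfolio $\pi_s=\frac{\mu_s-r_s}{\sigma_s^2}+\frac{B_T-B_s}{\sigma_s(T-s)}$, as specified in the context. Then for every $0<t<T$ there is a subset of the sample space of positive measure on which the honest trader gets more logarithmic utility than the insider, i.e. $$\mathbb{P}\left(\log\left.\frac{M_t}{M_0}\right|_{\text{Insider}}-\log\left.\frac{M_t}{M_0}\right|_{\text{Honest}}<0\right)>0.$$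
   Context: Forward integral: a stochastic process $\phi$ on $[0,\tau]$ is forward integrable with respect to a standard Brownian motion $B$ if there is a process $I$ such that $\sup_{0\le t\le \tau}\left|\int_0^t\phi_s\,\frac{B_{s+\epsilon}-B_s}{\epsilon}\,ds-I_t\right|\to0$ in probability as $\epsilon\to0^+$; then one writes $I_t=\int_0^t\phi_s\,d^-B_s$. If $\phi$ is Itô integrable, the forward integral coincides with the Itô integral. The integrand $\phi$ may be anticipating (not adapted to the filtration of $B$). Below it is used on $[0,t]$ with $t<T$. Market: $r_s$ is the risk-free rate, $\mu_s$ the expected return and $\sigma_s$ the volatility of the stock; $M_0>0$ is a constant initial wealth. The wealth of a trader with portfolio $\pi$ solves, for $0\le s\le t<T$, $$d^-M_s=[(1-\pi_s)r_sM_s+\pi_s\mu_sM_s]\,ds+\pi_s\sigma_sM_s\,d^-B_s,$$ where for the honest trader ($\pi$ adapted to $\mathcal{F}_s=\sigma\{B_u:0\le u\le s\}$) this is an ordinary Itô equation, and for the insider $\pi$ is adapted to $\sigma\{B_u:0\le u\le s\}\vee\sigma\{B_T\}$ and the equation is understood with the forward integral. The solution is $$\frac{M_t}{M_0}=\exp\left\{\int_0^t\left[(1-\pi_s)r_s+\pi_s\mu_s-\tfrac12\pi_s^2\sigma_s^2\right]ds+\int_0^t\pi_s\sigma_s\,d^-B_s\right\}.$$ With the two portfolios in the claim (which maximize the expected logarithmic utility $\mathbb{E}[\log(M_t/M_0)]$ in the respective classes), this gives $$\left.\frac{M_t}{M_0}\right|_{\text{Honest}}=\exp\left\{\int_0^t\left[r_s+\frac{(\mu_s-r_s)^2}{2\sigma_s^2}\right]ds+\int_0^t\frac{\mu_s-r_s}{\sigma_s}\,dB_s\right\},$$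 $$\left.\frac{M_t}{M_0}\right|_{\text{Insider}}=\left.\frac{M_t}{M_0}\right|_{\text{Honest}}\times\exp\left\{\int_0^t\frac{B_T-B_s}{T-s}\,d^-B_s-\frac12\int_0^t\frac{(B_T-B_s)^2}{(T-s)^2}\,ds\right\}.$$ These are the definitions of the two normalized wealths. The utility of a trader is $\log(M_t/M_0)$. *)

theory Defs
  imports "HOL-Probability.Probability"
begin

locale standard_brownian_motion = prob_space M for M :: "'a measure" +
  fixes B :: "real \<Rightarrow> 'a \<Rightarrow> real"
  assumes measurable_B: "\<And>s. 0 \<le> s \<Longrightarrow> B s \<in> borel_measurable M"
    and start_B: "AE \<omega> in M. B 0 \<omega> = 0"
    and normal_increments: "\<And>s u. 0 \<le> s \<Longrightarrow> s < u \<Longrightarrow>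
      distributed M lborel (\<lambda>\<omega>. B u \<omega> - B s \<omega>) (normal_density 0 (sqrt (u - s)))"
    and independent_increments: "\<And>(n::nat) p. 0 \<le> p 0 \<Longrightarrow> strict_mono_on {..n} p \<Longrightarrow>
      indep_vars (\<lambda>_. borel) (\<lambda>i \<omega>. B (p (Suc i)) \<omega> - B (p i) \<omega>) {..<n}"
    and continuous_paths: "\<And>\<omega>. \<omega> \<in> space M \<Longrightarrow> continuous_on {0..} (\<lambda>s. B s \<omega>)"

subsection \<open>Forward integral\<close>

definition forward_approx ::
    "(real \<Rightarrow> 'a \<Rightarrow> real) \<Rightarrow> (real \<Rightarrow> 'a \<Rightarrow> real) \<Rightarrow> real \<Rightarrow> real \<Rightarrow> 'a \<Rightarrow> real" where
  "forward_approx B \<phi> \<epsilon> u \<omega> =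
     (LINT s:{0..u}|lborel. \<phi> s \<omega> * ((B (s + \<epsilon>) \<omega> - B s \<omega>) / \<epsilon>))"

definition forward_error ::
    "(real \<Rightarrow> 'a \<Rightarrow> real) \<Rightarrow> (real \<Rightarrow> 'a \<Rightarrow> real) \<Rightarrow> real \<Rightarrow> (real \<Rightarrow> 'a \<Rightarrow> real) \<Rightarrow> real \<Rightarrow> 'a \<Rightarrow> ereal" where
  "forward_error B \<phi> \<tau> I \<epsilon> \<omega> = (SUP u\<in>{0..\<tau>}. ereal \<bar>forward_approx B \<phi> \<epsilon> u \<omega> - I u \<omega>\<bar>)"

text \<open>
  The integrability and measurability conjuncts are implicit in the usual definition. They are
  needed here because the library gives the integral of a non-integrable function and the measure
  of a non-measurable set the value 0.
\<close>

definition is_forward_integral ::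
    "'a measure \<Rightarrow> (real \<Rightarrow> 'a \<Rightarrow> real) \<Rightarrow> (real \<Rightarrow> 'a \<Rightarrow> real) \<Rightarrow> real \<Rightarrow> (real \<Rightarrow> 'a \<Rightarrow> real) \<Rightarrow> bool" where
  "is_forward_integral M B \<phi> \<tau> I \<longleftrightarrow>
     (\<forall>u\<in>{0..\<tau>}. I u \<in> borel_measurable M) \<and>
     (\<forall>\<epsilon>>0. AE \<omega> in M.
        set_integrable lborel {0..\<tau>} (\<lambda>s. \<phi> s \<omega> * ((B (s + \<epsilon>) \<omega> - B s \<omega>) / \<epsilon>))) \<and>
     (\<forall>\<epsilon>>0. forward_error B \<phi> \<tau> I \<epsilon> \<in> borel_measurable M) \<and>
     (\<forall>\<delta>>0. ((\<lambda>\<epsilon>. \<P>(\<omega> in M. forward_error B \<phi> \<tau> I \<epsilon> \<omega> > ereal \<delta>)) \<longlongrightarrow> 0) (at_right 0))"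

text \<open>
  The integral is determined only up to a null set at each time, so an arbitrary version is
  selected; nothing is known about the result unless a forward integral exists.
\<close>

definition forward_integral ::
    "'a measure \<Rightarrow> (real \<Rightarrow> 'a \<Rightarrow> real) \<Rightarrow> (real \<Rightarrow> 'a \<Rightarrow> real) \<Rightarrow> real \<Rightarrow> 'a \<Rightarrow> real" where
  "forward_integral M B \<phi> \<tau> = (SOME I. is_forward_integral M B \<phi> \<tau> I) \<tau>"

subsection \<open>Ito integral\<close>

definition natural_filtration :: "'a measure \<Rightarrow> (real \<Rightarrow> 'a \<Rightarrow> real) \<Rightarrow> real \<Rightarrow> 'a measure" where
  "natural_filtration M B s =
     sigma (space M) {B u -` A \<inter> space M | u A. 0 \<le> u \<and> u \<le> s \<and> A \<in> sets borel}"

text \<open>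
  A simple process on \<open>[0, \<tau>]\<close> is given by a partition \<open>0 = p 0 < \<dots> < p n = \<tau>\<close> and
  bounded coefficients \<open>\<xi> i\<close>, known at time \<open>p i\<close> and used on the \<open>i\<close>-th subinterval.
\<close>

definition is_simple_process ::
    "'a measure \<Rightarrow> (real \<Rightarrow> 'a \<Rightarrow> real) \<Rightarrow> real \<Rightarrow> nat \<Rightarrow> (nat \<Rightarrow> real) \<Rightarrow> (nat \<Rightarrow> 'a \<Rightarrow> real) \<Rightarrow> bool" where
  "is_simple_process M B \<tau> n p \<xi> \<longleftrightarrow>
     p 0 = 0 \<and> p n = \<tau> \<and> strict_mono_on {..n} p \<and>
     (\<forall>i<n. \<xi> i \<in> borel_measurable (natural_filtration M B (p i)) \<and>
            (\<exists>C. \<forall>\<omega>\<in>space M. \<bar>\<xi> i \<omega>\<bar> \<le> C))"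

definition simple_process ::
    "nat \<Rightarrow> (nat \<Rightarrow> real) \<Rightarrow> (nat \<Rightarrow> 'a \<Rightarrow> real) \<Rightarrow> real \<Rightarrow> 'a \<Rightarrow> real" where
  "simple_process n p \<xi> s \<omega> = (\<Sum>i<n. \<xi> i \<omega> * indicator {p i<..p (Suc i)} s)"

definition simple_integral ::
    "(real \<Rightarrow> 'a \<Rightarrow> real) \<Rightarrow> nat \<Rightarrow> (nat \<Rightarrow> real) \<Rightarrow> (nat \<Rightarrow> 'a \<Rightarrow> real) \<Rightarrow> 'a \<Rightarrow> real" where
  "simple_integral B n p \<xi> \<omega> = (\<Sum>i<n. \<xi> i \<omega> * (B (p (Suc i)) \<omega> - B (p i) \<omega>))"

definition is_ito_integral ::
    "'a measure \<Rightarrow> (real \<Rightarrow> 'a \<Rightarrow> real) \<Rightarrow> (real \<Rightarrow> 'a \<Rightarrow> real) \<Rightarrow> real \<Rightarrow> ('a \<Rightarrow> real) \<Rightarrow> bool" where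
  "is_ito_integral M B \<phi> \<tau> I \<longleftrightarrow>
     (\<lambda>(s, \<omega>). \<phi> s \<omega>) \<in> borel_measurable (restrict_space lborel {0..\<tau>} \<Otimes>\<^sub>M M) \<and>
     I \<in> borel_measurable M \<and>
     (\<exists>n p \<xi>. (\<forall>k. is_simple_process M B \<tau> (n k) (p k) (\<xi> k)) \<and>
       (\<lambda>k. \<integral>\<^sup>+\<omega>. (\<integral>\<^sup>+s\<in>{0..\<tau>}.
          ennreal ((simple_process (n k) (p k) (\<xi> k) s \<omega> - \<phi> s \<omega>)\<^sup>2) \<partial>lborel) \<partial>M) \<longlonglongrightarrow> 0 \<and>
       (\<lambda>k. \<integral>\<^sup>+\<omega>. ennreal ((simple_integral B (n k) (p k) (\<xi> k) \<omega> - I \<omega>)\<^sup>2) \<partial>M) \<longlonglongrightarrow> 0)"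

definition ito_integral ::
    "'a measure \<Rightarrow> (real \<Rightarrow> 'a \<Rightarrow> real) \<Rightarrow> (real \<Rightarrow> 'a \<Rightarrow> real) \<Rightarrow> real \<Rightarrow> 'a \<Rightarrow> real" where
  "ito_integral M B \<phi> \<tau> = (SOME I. is_ito_integral M B \<phi> \<tau> I)"

subsection \<open>Normalized wealths\<close>

definition honest_portfolio ::
    "(real \<Rightarrow> real) \<Rightarrow> (real \<Rightarrow> real) \<Rightarrow> (real \<Rightarrow> real) \<Rightarrow> real \<Rightarrow> real" where
  "honest_portfolio r \<mu> \<sigma> s = (\<mu> s - r s) / (\<sigma> s)\<^sup>2"

definition insider_portfolio ::
    "(real \<Rightarrow> 'a \<Rightarrow> real) \<Rightarrow> (real \<Rightarrow> real) \<Rightarrow> (real \<Rightarrow> real) \<Rightarrow> (real \<Rightarrow> real) \<Rightarrow> real \<Rightarrow> real \<Rightarrow> 'a \<Rightarrow> real" where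
  "insider_portfolio B r \<mu> \<sigma> T s \<omega> =
     (\<mu> s - r s) / (\<sigma> s)\<^sup>2 + (B T \<omega> - B s \<omega>) / (\<sigma> s * (T - s))"

definition log_drift :: "real \<Rightarrow> real \<Rightarrow> real \<Rightarrow> real \<Rightarrow> real" where
  "log_drift r \<mu> \<sigma> \<pi> = (1 - \<pi>) * r + \<pi> * \<mu> - \<pi>\<^sup>2 * \<sigma>\<^sup>2 / 2"

definition honest_wealth ::
    "'a measure \<Rightarrow> (real \<Rightarrow> 'a \<Rightarrow> real) \<Rightarrow> (real \<Rightarrow> real) \<Rightarrow> (real \<Rightarrow> real) \<Rightarrow> (real \<Rightarrow> real) \<Rightarrow> real \<Rightarrow> 'a \<Rightarrow> real" where
  "honest_wealth M B r \<mu> \<sigma> t \<omega> =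
     exp ((LINT s:{0..t}|lborel. r s + (\<mu> s - r s)\<^sup>2 / (2 * (\<sigma> s)\<^sup>2)) +
          ito_integral M B (\<lambda>s \<omega>. (\<mu> s - r s) / \<sigma> s) t \<omega>)"

definition insider_wealth ::
    "'a measure \<Rightarrow> (real \<Rightarrow> 'a \<Rightarrow> real) \<Rightarrow> (real \<Rightarrow> real) \<Rightarrow> (real \<Rightarrow> real) \<Rightarrow> (real \<Rightarrow> real) \<Rightarrow> real \<Rightarrow> real \<Rightarrow> 'a \<Rightarrow> real" where
  "insider_wealth M B r \<mu> \<sigma> T t \<omega> =
     honest_wealth M B r \<mu> \<sigma> t \<omega> *
     exp (forward_integral M B (\<lambda>s \<omega>. (B T \<omega> - B s \<omega>) / (T - s)) t \<omega> -
          (LINT s:{0..t}|lborel. (B T \<omega> - B s \<omega>)\<^sup>2 / (T - s)\<^sup>2) / 2)"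

text \<open>
  The wealth equation with portfolio \<open>\<pi>\<close> has the solution
  \<open>exp (\<integral> log_drift (r s) (\<mu> s) (\<sigma> s) (\<pi> s) ds + \<integral> \<pi> s * \<sigma> s d\<^sup>-B s)\<close>. The following
  identities connect the integrands in the two wealths with this formula.
\<close>

lemma honest_coefficients:
  assumes "\<sigma> s > 0"
  shows "log_drift (r s) (\<mu> s) (\<sigma> s) (honest_portfolio r \<mu> \<sigma> s) =
           r s + (\<mu> s - r s)\<^sup>2 / (2 * (\<sigma> s)\<^sup>2)"
    and "honest_portfolio r \<mu> \<sigma> s * \<sigma> s = (\<mu> s - r s) / \<sigma> s"
  using assms by (simp_all add: log_drift_def honest_portfolio_def field_simps power2_eq_square)

lemma insider_coefficients:
  assumes "\<sigma> s > 0" and "s < T"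
  shows "log_drift (r s) (\<mu> s) (\<sigma> s) (insider_portfolio B r \<mu> \<sigma> T s \<omega>) =
           r s + (\<mu> s - r s)\<^sup>2 / (2 * (\<sigma> s)\<^sup>2) - (B T \<omega> - B s \<omega>)\<^sup>2 / (T - s)\<^sup>2 / 2"
    and "insider_portfolio B r \<mu> \<sigma> T s \<omega> * \<sigma> s =
           (\<mu> s - r s) / \<sigma> s + (B T \<omega> - B s \<omega>) / (T - s)"
proof -
  define a where "a = (\<mu> s - r s) / \<sigma> s"
  define b where "b = (B T \<omega> - B s \<omega>) / (T - s)"
  define p where "p = insider_portfolio B r \<mu> \<sigma> T s \<omega>"
  have p: "p * \<sigma> s = a + b"
    using assms by (simp add: p_def insider_portfolio_def a_def b_def field_simps power2_eq_square)
  have m: "\<mu> s - r s = a * \<sigma> s"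
    using assms by (simp add: a_def)
  have "log_drift (r s) (\<mu> s) (\<sigma> s) p = r s + p * (\<mu> s - r s) - (p * \<sigma> s)\<^sup>2 / 2"
    by (simp add: log_drift_def power_mult_distrib algebra_simps)
  also have "p * (\<mu> s - r s) = a * (p * \<sigma> s)"
    by (simp add: m)
  finally have "log_drift (r s) (\<mu> s) (\<sigma> s) p = r s + a * (a + b) - (a + b)\<^sup>2 / 2"
    by (simp add: p)
  also have "\<dots> = r s + a\<^sup>2 / 2 - b\<^sup>2 / 2"
    by (simp add: power2_eq_square field_simps)
  finally show "log_drift (r s) (\<mu> s) (\<sigma> s) (insider_portfolio B r \<mu> \<sigma> T s \<omega>) =
      r s + (\<mu> s - r s)\<^sup>2 / (2 * (\<sigma> s)\<^sup>2) - (B T \<omega> - B s \<omega>)\<^sup>2 / (T - s)\<^sup>2 / 2"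
    by (simp add: p_def a_def b_def power_divide)
  show "insider_portfolio B r \<mu> \<sigma> T s \<omega> * \<sigma> s =
      (\<mu> s - r s) / \<sigma> s + (B T \<omega> - B s \<omega>) / (T - s)"
    using p by (simp add: p_def a_def b_def)
qed

end

(*
  Let Y s = B T - B s. Since B (s + e) - B s = Y s - Y (s + e),
    Y s * (B (s + e) - B s) = (Y s ^ 2 - Y (s + e) ^ 2 + (B (s + e) - B s) ^ 2) / 2.
  Weighted with g, divided by e and integrated, the difference of squares converges pathwise, uniformly in the
  upper limit u, to g 0 * Y 0 ^ 2 - g u * Y u ^ 2 + (integral of g' * Y ^ 2) by integration by parts,
  and the last square converges in probability to the integral of g (quadratic variation). For
  g s = 1 / (T - s) the integral of Y ^ 2 / (T - s) ^ 2 cancels against the one in the insider's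
  wealth, and almost surely the difference of the logarithmic utilities at time t is
    ((B T - B 0) ^ 2 / T - (B T - B t) ^ 2 / (T - t) + ln (T / (T - t))) / 2.
  It is negative when B T - B t is large and B t - B 0 is close to its negative, and by independence
  of the two increments this has positive probability.
*)

theory Submission
  imports Defs
begin

section \<open>Pathwise calculus: integration by parts for difference quotients\<close>

text \<open>The difference quotient of the merely continuous \<open>y\<close> is the derivative of
  its moving average \<open>Z s\<close>, the mean of \<open>y\<close> over
  \<open>{s..s + \<epsilon>}\<close>. Hence \<open>g\<close> can be integrated by parts against
  \<open>Z\<close>. Replacing \<open>Z\<close> by \<open>y\<close> afterwards costs at most
  \<open>\<eta>\<close> at each point: \<open>C * \<eta>\<close> in each of the two boundary terms
  and \<open>u * C' * \<eta>\<close> in the integral.\<close>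

lemma integral_shifted_difference_bound:
  fixes y g g' :: "real \<Rightarrow> real"
  assumes \<epsilon>: "0 < \<epsilon>" and u: "0 \<le> u"
    and y: "continuous_on {0..u + \<epsilon>} y"
    and g: "\<And>s. s \<in> {0..u} \<Longrightarrow> (g has_real_derivative g' s) (at s within {0..u})"
    and g': "continuous_on {0..u} g'"
    and C: "\<And>s. s \<in> {0..u} \<Longrightarrow> \<bar>g s\<bar> \<le> C"
    and C': "\<And>s. s \<in> {0..u} \<Longrightarrow> \<bar>g' s\<bar> \<le> C'"
    and \<eta>: "\<And>s v. \<lbrakk>0 \<le> s; s \<le> u; s \<le> v; v \<le> s + \<epsilon>\<rbrakk> \<Longrightarrow> \<bar>y v - y s\<bar> \<le> \<eta>"
  shows "\<bar>integral {0..u} (\<lambda>s. g s * ((y s - y (s + \<epsilon>)) / \<epsilon>)) -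
      (g 0 * y 0 - g u * y u + integral {0..u} (\<lambda>s. g' s * y s))\<bar> \<le> (2 * C + u * C') * \<eta>"
proof -
  define P where "P v = integral {0..v} y" for v
  define Z where "Z s = (P (s + \<epsilon>) - P s) / \<epsilon>" for s
  have P: "(P has_real_derivative y v) (at v within {0..u + \<epsilon>})" if "v \<in> {0..u + \<epsilon>}" for v
    unfolding P_def has_real_derivative_iff_has_vector_derivative
    by (rule integral_has_vector_derivative[OF y that])
  have Z: "(Z has_real_derivative (y (s + \<epsilon>) - y s) / \<epsilon>) (at s within {0..u})"
    if s: "s \<in> {0..u}" for s
  proof -
    have "(P has_real_derivative y (s + \<epsilon>)) (at (s + \<epsilon>) within (\<lambda>s. s + \<epsilon>) ` {0..u})"
      by (rule DERIV_subset[OF P]) (use s \<epsilon> in auto)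
    then have "((P \<circ> (\<lambda>s. s + \<epsilon>)) has_real_derivative y (s + \<epsilon>) * 1) (at s within {0..u})"
      by (rule DERIV_image_chain) (auto intro!: derivative_eq_intros)
    moreover have "(P has_real_derivative y s) (at s within {0..u})"
      by (rule DERIV_subset[OF P]) (use s \<epsilon> in auto)
    ultimately show ?thesis
      unfolding Z_def using \<epsilon> by (auto intro!: derivative_eq_intros simp: o_def)
  qed
  have contZ: "continuous_on {0..u} Z" and contg: "continuous_on {0..u} g"
    using DERIV_continuous_on[OF Z] DERIV_continuous_on[OF g] by auto
  have conty: "continuous_on {0..u} y" "continuous_on {0..u} (\<lambda>s. y (s + \<epsilon>))"
    using \<epsilon> by (auto intro!: continuous_on_subset[OF y] continuous_on_compose2[OF y] continuous_intros)
  have Zy: "\<bar>Z s - y s\<bar> \<le> \<eta>" if s: "s \<in> {0..u}" for s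
  proof -
    have c: "continuous_on {s..s + \<epsilon>} y"
      using s by (intro continuous_on_subset[OF y]) auto
    have i: "y integrable_on {0..s + \<epsilon>}"
      using s by (intro integrable_continuous_real continuous_on_subset[OF y]) auto
    have "P (s + \<epsilon>) - P s = integral {s..s + \<epsilon>} y"
      using Henstock_Kurzweil_Integration.integral_combine[where a=0 and c=s and b="s+\<epsilon>", OF _ _ i] s \<epsilon>
      by (simp add: P_def)
    moreover have "integral {s..s + \<epsilon>} (\<lambda>v. y v - y s) = integral {s..s + \<epsilon>} y - \<epsilon> * y s"
      using c \<epsilon> by (subst integral_diff) (auto intro: integrable_continuous_real)
    ultimately have "Z s - y s = integral {s..s + \<epsilon>} (\<lambda>v. y v - y s) / \<epsilon>"
      using \<epsilon> by (simp add: Z_def field_simps)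
    moreover have "norm (integral {s..s + \<epsilon>} (\<lambda>v. y v - y s)) \<le> \<eta> * (s + \<epsilon> - s)"
      using s \<epsilon> \<eta>[of s] c by (intro integral_bound continuous_intros) auto
    ultimately show ?thesis
      using \<epsilon> by (simp add: pos_divide_le_eq mult.commute)
  qed
  have "((\<lambda>s. g' s * Z s + g s * ((y (s + \<epsilon>) - y s) / \<epsilon>)) has_integral
      (g u * Z u - g 0 * Z 0)) {0..u}"
    using u by (intro fundamental_theorem_of_calculus)
      (auto intro!: derivative_eq_intros g Z simp flip: has_real_derivative_iff_has_vector_derivative)
  moreover have i1: "(\<lambda>s. g' s * Z s) integrable_on {0..u}" "(\<lambda>s. g' s * y s) integrable_on {0..u}"
    and i2: "(\<lambda>s. g s * ((y (s + \<epsilon>) - y s) / \<epsilon>)) integrable_on {0..u}"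
    using \<epsilon> by (auto intro!: integrable_continuous_real continuous_intros g' contZ contg conty)
  ultimately have "g u * Z u - g 0 * Z 0 =
      integral {0..u} (\<lambda>s. g' s * Z s) + integral {0..u} (\<lambda>s. g s * ((y (s + \<epsilon>) - y s) / \<epsilon>))"
    by (subst integral_add[symmetric, OF i1(1) i2]) (rule integral_unique[symmetric])
  moreover have "integral {0..u} (\<lambda>s. g s * ((y s - y (s + \<epsilon>)) / \<epsilon>)) =
      - integral {0..u} (\<lambda>s. g s * ((y (s + \<epsilon>) - y s) / \<epsilon>))"
    by (subst integral_neg[symmetric]) (simp add: algebra_simps diff_divide_distrib)
  moreover have "integral {0..u} (\<lambda>s. g' s * (Z s - y s)) =
      integral {0..u} (\<lambda>s. g' s * Z s) - integral {0..u} (\<lambda>s. g' s * y s)"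
    using i1 by (simp add: integral_diff algebra_simps)
  ultimately have eq: "integral {0..u} (\<lambda>s. g s * ((y s - y (s + \<epsilon>)) / \<epsilon>)) -
      (g 0 * y 0 - g u * y u + integral {0..u} (\<lambda>s. g' s * y s)) =
      g 0 * (Z 0 - y 0) - g u * (Z u - y u) + integral {0..u} (\<lambda>s. g' s * (Z s - y s))"
    by (simp add: algebra_simps)
  have \<eta>0: "0 \<le> \<eta>" and C0: "0 \<le> C" and C'0: "0 \<le> C'"
    using \<eta>[of 0 0] u \<epsilon> C[of 0] C'[of 0] by auto
  have "norm (integral {0..u} (\<lambda>s. g' s * (Z s - y s))) \<le> (C' * \<eta>) * (u - 0)"
    using u C' Zy C'0 \<eta>0 by (intro integral_bound continuous_intros g' contZ conty)
      (auto simp: abs_mult intro!: mult_mono)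
  moreover have "\<bar>g 0 * (Z 0 - y 0)\<bar> \<le> C * \<eta>" "\<bar>g u * (Z u - y u)\<bar> \<le> C * \<eta>"
    using u C Zy C0 \<eta>0 by (auto simp: abs_mult intro!: mult_mono)
  ultimately show ?thesis
    unfolding eq by (simp add: algebra_simps)
qed

text \<open>Uniform continuity of \<open>y\<close> supplies one \<open>\<eta>\<close> for all upper
  limits. The quantifier over \<open>u\<close> stands inside the eventuality because
  \<open>forward_error\<close> is a supremum over \<open>u\<close>.\<close>

lemma eventually_integral_shifted_difference:
  fixes y g g' :: "real \<Rightarrow> real"
  assumes "0 \<le> t" and y: "continuous_on {0..} y"
    and g: "\<And>s. s \<in> {0..t} \<Longrightarrow> (g has_real_derivative g' s) (at s within {0..t})"
    and g': "continuous_on {0..t} g'"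
    and "0 < e"
  shows "\<forall>\<^sub>F \<epsilon> in at_right 0. \<forall>u\<in>{0..t}.
    \<bar>integral {0..u} (\<lambda>s. g s * ((y s - y (s + \<epsilon>)) / \<epsilon>)) -
      (g 0 * y 0 - g u * y u + integral {0..u} (\<lambda>s. g' s * y s))\<bar> \<le> e"
proof -
  have contg: "continuous_on {0..t} g"
    using g by (rule DERIV_continuous_on)
  have "bounded (g ` {0..t})"
    by (intro compact_imp_bounded compact_continuous_image contg compact_Icc)
  then obtain C where C: "\<And>s. s \<in> {0..t} \<Longrightarrow> \<bar>g s\<bar> \<le> C"
    unfolding bounded_iff real_norm_def by blast
  have "bounded (g' ` {0..t})"
    by (intro compact_imp_bounded compact_continuous_image g' compact_Icc)
  then obtain C' where C': "\<And>s. s \<in> {0..t} \<Longrightarrow> \<bar>g' s\<bar> \<le> C'"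
    unfolding bounded_iff real_norm_def by blast
  have C0: "0 \<le> C" "0 \<le> C'"
    using C[of 0] C'[of 0] assms(1) by auto
  \<comment> \<open>The summand 1 keeps the denominator positive when \<open>C\<close> and
    \<open>C'\<close> vanish.\<close>
  define \<eta> where "\<eta> = e / (2 * C + t * C' + 1)"
  have \<eta>: "0 < \<eta>" "(2 * C + t * C') * \<eta> \<le> e"
    using assms(1,5) C0 by (auto simp: \<eta>_def divide_le_eq add_nonneg_pos intro!: divide_pos_pos)
  \<comment> \<open>The interval is lengthened by 1 to contain \<open>s + \<epsilon>\<close> for all
    \<open>s\<close> up to \<open>t\<close> and \<open>\<epsilon> < 1\<close>.\<close>
  have "uniformly_continuous_on {0..t + 1} y"
    by (intro compact_uniformly_continuous continuous_on_subset[OF y]) auto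
  then obtain d where d: "0 < d"
    "\<And>s v. \<lbrakk>s \<in> {0..t + 1}; v \<in> {0..t + 1}; dist v s < d\<rbrakk> \<Longrightarrow> dist (y v) (y s) < \<eta>"
    using \<eta>(1) unfolding uniformly_continuous_on_def by metis
  have "\<forall>\<^sub>F \<epsilon> in at_right 0. 0 < \<epsilon> \<and> \<epsilon> < min d 1"
    using d(1) by (intro eventually_at_rightI[of 0 "min d 1"]) auto
  then show ?thesis
  proof (eventually_elim, intro ballI)
    fix \<epsilon> u assume \<epsilon>: "0 < \<epsilon> \<and> \<epsilon> < min d 1" and u: "u \<in> {0..t}"
    have "\<bar>integral {0..u} (\<lambda>s. g s * ((y s - y (s + \<epsilon>)) / \<epsilon>)) -
      (g 0 * y 0 - g u * y u + integral {0..u} (\<lambda>s. g' s * y s))\<bar> \<le> (2 * C + u * C') * \<eta>"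
    proof (rule integral_shifted_difference_bound)
      show "continuous_on {0..u + \<epsilon>} y" by (rule continuous_on_subset[OF y]) auto
      show "continuous_on {0..u} g'" by (rule continuous_on_subset[OF g']) (use u in auto)
      show "(g has_real_derivative g' s) (at s within {0..u})" if "s \<in> {0..u}" for s
        by (rule DERIV_subset[OF g]) (use that u in auto)
      show "\<bar>y v - y s\<bar> \<le> \<eta>" if "0 \<le> s" "s \<le> u" "s \<le> v" "v \<le> s + \<epsilon>" for s v
        using d(2)[of s v] that u \<epsilon> by (auto simp: dist_real_def)
    qed (use u \<epsilon> C C' in auto)
    also have "\<dots> \<le> (2 * C + t * C') * \<eta>"
      using u C0 \<eta>(1) by (auto intro!: mult_right_mono add_left_mono)
    finally show "\<bar>integral {0..u} (\<lambda>s. g s * ((y s - y (s + \<epsilon>)) / \<epsilon>)) -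
      (g 0 * y 0 - g u * y u + integral {0..u} (\<lambda>s. g' s * y s))\<bar> \<le> e"
      using \<eta>(2) by linarith
  qed
qed

section \<open>Measurability for processes with continuous paths\<close>

text \<open>A sublevel set of \<open>f\<close> in \<open>S\<close> is closed, so it contains the
  closure of \<open>D\<close> as soon as it contains \<open>D\<close>.\<close>

lemma SUP_continuous_on_dense:
  fixes f :: "'b :: topological_space \<Rightarrow> real"
  assumes f: "continuous_on S f" and "closed S" and D: "D \<subseteq> S" "S \<subseteq> closure D"
  shows "(SUP u\<in>S. ereal (f u)) = (SUP u\<in>D. ereal (f u))"
proof (rule antisym)
  show "(SUP u\<in>S. ereal (f u)) \<le> (SUP u\<in>D. ereal (f u))"
  proof (rule ereal_le_real)
    fix c assume c: "(SUP u\<in>D. ereal (f u)) \<le> ereal c"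
    have "closed {u \<in> S. f u \<le> c}"
      by (intro continuous_on_closed_Collect_le continuous_on_const f assms(2))
    moreover have "D \<subseteq> {u \<in> S. f u \<le> c}"
      using D(1) c by (auto simp: SUP_le_iff)
    ultimately have "closure D \<subseteq> {u \<in> S. f u \<le> c}"
      by (rule closure_minimal[rotated])
    then show "(SUP u\<in>S. ereal (f u)) \<le> ereal c"
      using D(2) by (auto intro!: SUP_least)
  qed
qed (intro SUP_subset_mono D order_refl)

text \<open>Measurability can fail for a supremum over uncountably many indices; continuity reduces
  it to a countable dense set of indices. This is applied to \<open>forward_error\<close>.\<close>

lemma borel_measurable_SUP_continuous:
  fixes X :: "'b :: {metric_space, second_countable_topology} \<Rightarrow> 'a \<Rightarrow> real"
  assumes "closed S" and X: "\<And>u. u \<in> S \<Longrightarrow> X u \<in> borel_measurable M"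
    and cont: "\<And>\<omega>. \<omega> \<in> space M \<Longrightarrow> continuous_on S (\<lambda>u. X u \<omega>)"
  shows "(\<lambda>\<omega>. SUP u\<in>S. ereal (X u \<omega>)) \<in> borel_measurable M"
proof -
  obtain D where D: "countable D" "D \<subseteq> S" "S \<subseteq> closure D"
    using separable[of S] by blast
  have "(\<lambda>\<omega>. SUP u\<in>D. ereal (X u \<omega>)) \<in> borel_measurable M"
    using D X by (intro borel_measurable_SUP) auto
  then show ?thesis
    by (rule measurable_cong[THEN iffD2, rotated])
      (rule SUP_continuous_on_dense[OF cont assms(1) D(2,3)])
qed

text \<open>Joint measurability, needed for Fubini, comes from discretizing time: the process frozen
  at times \<open>\<lfloor>(n + 1) * s\<rfloor> / (n + 1)\<close> takes countably many times, hence
  is jointly measurable, and path continuity gives convergence as \<open>n\<close> grows.\<close>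

lemma borel_measurable_continuous_process:
  fixes X :: "real \<Rightarrow> 'a \<Rightarrow> real"
  assumes "a \<le> b" and X: "\<And>s. s \<in> {a..b} \<Longrightarrow> X s \<in> borel_measurable M"
    and cont: "\<And>\<omega>. \<omega> \<in> space M \<Longrightarrow> continuous_on {a..b} (\<lambda>s. X s \<omega>)"
  shows "(\<lambda>x. indicat_real {a..b} (fst x) * X (fst x) (snd x)) \<in> borel_measurable (borel \<Otimes>\<^sub>M M)"
proof -
  \<comment> \<open>Discretized times may fall below \<open>a\<close>, and nothing is known of
    \<open>X\<close> outside \<open>{a..b}\<close>; clamping by \<open>c\<close> brings them back
    without changing times inside.\<close>
  define c where "c s = max a (min b s)" for s
  have c: "c s \<in> {a..b}" for s
    using assms(1) by (auto simp: c_def)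
  have "(\<lambda>x::real \<times> 'a. X (c (fst x)) (snd x)) \<in> borel_measurable (borel \<Otimes>\<^sub>M M)"
  proof (rule borel_measurable_LIMSEQ_real)
    fix x :: "real \<times> 'a" assume "x \<in> space (borel \<Otimes>\<^sub>M M)"
    then have \<omega>: "snd x \<in> space M"
      by (auto simp: space_pair_measure)
    have "(\<lambda>n. of_int \<lfloor>real (Suc n) * fst x\<rfloor> / real (Suc n)) \<longlonglongrightarrow> fst x"
    proof (rule tendsto_sandwich[OF _ _ _ tendsto_const])
      show "(\<lambda>n. fst x - 1 / real (Suc n)) \<longlonglongrightarrow> fst x"
        using tendsto_diff[OF tendsto_const LIMSEQ_inverse_real_of_nat, of "fst x"]
        by (simp add: inverse_eq_divide)
      show "\<forall>\<^sub>F n in sequentially. fst x - 1 / real (Suc n) \<le> of_int \<lfloor>real (Suc n) * fst x\<rfloor> / real (Suc n)"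
      proof (intro always_eventually allI)
        fix n
        have "real (Suc n) * fst x - 1 \<le> of_int \<lfloor>real (Suc n) * fst x\<rfloor>"
          by linarith
        then have "(real (Suc n) * fst x - 1) / real (Suc n) \<le> of_int \<lfloor>real (Suc n) * fst x\<rfloor> / real (Suc n)"
          by (rule divide_right_mono) simp
        then show "fst x - 1 / real (Suc n) \<le> of_int \<lfloor>real (Suc n) * fst x\<rfloor> / real (Suc n)"
          by (simp add: diff_divide_distrib del: of_nat_Suc)
      qed
      show "\<forall>\<^sub>F n in sequentially. of_int \<lfloor>real (Suc n) * fst x\<rfloor> / real (Suc n) \<le> fst x"
        by (intro always_eventually allI) (simp add: field_simps del: of_nat_Suc)
    qed
    then have "(\<lambda>n. c (of_int \<lfloor>real (Suc n) * fst x\<rfloor> / real (Suc n))) \<longlonglongrightarrow> c (fst x)"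
      unfolding c_def by (intro tendsto_intros)
    then show "(\<lambda>n. X (c (of_int \<lfloor>real (Suc n) * fst x\<rfloor> / real (Suc n))) (snd x)) \<longlonglongrightarrow> X (c (fst x)) (snd x)"
      using c by (intro continuous_on_tendsto_compose[OF cont[OF \<omega>]]) auto
  next
    fix n
    show "(\<lambda>x::real \<times> 'a. X (c (of_int \<lfloor>real (Suc n) * fst x\<rfloor> / real (Suc n))) (snd x)) \<in> borel_measurable (borel \<Otimes>\<^sub>M M)"
    proof (rule measurable_compose_countable[where f="\<lambda>i x. X (c (of_int i / real (Suc n))) (snd x)"
          and g="\<lambda>x. \<lfloor>real (Suc n) * fst x\<rfloor>"])
      show "(\<lambda>x. X (c (of_int i / real (Suc n))) (snd x)) \<in> borel_measurable (borel \<Otimes>\<^sub>M M)" for i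
        by (rule measurable_compose[OF measurable_snd X[OF c]])
    qed measurable
  qed
  then have "(\<lambda>x. indicat_real {a..b} (fst x) * X (c (fst x)) (snd x)) \<in> borel_measurable (borel \<Otimes>\<^sub>M M)"
    by measurable
  also have "(\<lambda>x. indicat_real {a..b} (fst x) * X (c (fst x)) (snd x)) =
      (\<lambda>x. indicat_real {a..b} (fst x) * X (fst x) (snd x))"
    by (auto simp: c_def indicator_def fun_eq_iff)
  finally show ?thesis .
qed

lemma borel_measurable_set_integral_continuous:
  fixes X :: "real \<Rightarrow> 'a \<Rightarrow> real"
  assumes "a \<le> b" and "\<And>s. s \<in> {a..b} \<Longrightarrow> X s \<in> borel_measurable M"
    and "\<And>\<omega>. \<omega> \<in> space M \<Longrightarrow> continuous_on {a..b} (\<lambda>s. X s \<omega>)"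
  shows "(\<lambda>\<omega>. LINT s:{a..b}|lborel. X s \<omega>) \<in> borel_measurable M"
proof -
  have "(\<lambda>p. indicator {a..b} (snd p) * X (snd p) (fst p)) \<in> borel_measurable (M \<Otimes>\<^sub>M borel)"
    using measurable_compose[OF measurable_pair_swap' borel_measurable_continuous_process[OF assms]]
    by (simp add: case_prod_beta)
  then show ?thesis
    unfolding set_lebesgue_integral_def
    by (intro lborel.borel_measurable_lebesgue_integral) (simp add: case_prod_beta)
qed

lemma continuous_on_set_integral:
  fixes f :: "real \<Rightarrow> real"
  assumes "continuous_on {a..b} f"
  shows "continuous_on {a..b} (\<lambda>u. LINT s:{a..u}|lborel. f s)"
proof -
  have "continuous_on {a..b} (\<lambda>u. integral {a..u} f)"
    by (intro indefinite_integral_continuous_1 integrable_continuous_real assms)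
  then show ?thesis
    by (rule continuous_on_eq)
      (auto intro!: set_borel_integral_eq_integral(2)[symmetric] borel_integrable_atLeastAtMost'
        continuous_on_subset[OF assms])
qed

section \<open>Convergence in probability and uniqueness of the forward integral\<close>

text \<open>Pathwise convergence implies convergence in probability, by dominated convergence of
  indicators along sequences tending to 0. The threshold below which \<open>\<omega>\<close> leaves
  \<open>E \<epsilon>\<close> may depend on \<open>\<omega>\<close> in any way; only the sets
  \<open>E \<epsilon>\<close> must be measurable.\<close>

lemma (in prob_space) tendsto_prob_0_at_right:
  fixes E :: "real \<Rightarrow> 'a set"
  assumes E: "\<And>\<epsilon>. 0 < \<epsilon> \<Longrightarrow> E \<epsilon> \<in> events"
    and ev: "\<And>\<omega>. \<omega> \<in> space M \<Longrightarrow> \<forall>\<^sub>F \<epsilon> in at_right 0. \<omega> \<notin> E \<epsilon>"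
  shows "((\<lambda>\<epsilon>. prob (E \<epsilon>)) \<longlongrightarrow> 0) (at_right 0)"
proof (rule tendsto_at_right_sequentially[where b=1])
  fix S :: "nat \<Rightarrow> real" assume S: "\<And>n. 0 < S n" "S \<longlonglongrightarrow> 0"
  then have S0: "filterlim S (at_right 0) sequentially"
    by (auto simp: filterlim_at less_imp_neq[OF S(1), symmetric])
  have "(\<lambda>n. expectation (indicat_real (E (S n)))) \<longlonglongrightarrow> expectation (\<lambda>_. 0)"
  proof (rule integral_dominated_convergence[where w="\<lambda>_. 1"])
    show "AE \<omega> in M. (\<lambda>n. indicat_real (E (S n)) \<omega>) \<longlonglongrightarrow> 0"
    proof (rule AE_I2)
      fix \<omega> assume "\<omega> \<in> space M"
      then have "\<forall>\<^sub>F n in sequentially. \<omega> \<notin> E (S n)"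
        using ev S0 by (auto simp: filterlim_iff)
      then show "(\<lambda>n. indicat_real (E (S n)) \<omega>) \<longlonglongrightarrow> 0"
        by (intro tendsto_eventually) (auto elim!: eventually_mono)
    qed
  qed (use E[OF S(1)] in \<open>auto simp: indicator_def\<close>)
  then show "(\<lambda>n. prob (E (S n))) \<longlonglongrightarrow> 0"
    using E[OF S(1)] by simp
qed simp

text \<open>Outside two events of vanishing probability, \<open>I u\<close> and \<open>J u\<close>
  are both within \<open>\<delta>\<close> of the same approximation. The lemma transfers an explicit
  formula to the version that \<open>forward_integral\<close> selects.\<close>

lemma (in prob_space) is_forward_integral_unique:
  assumes I: "is_forward_integral M B \<phi> \<tau> I" and J: "is_forward_integral M B \<phi> \<tau> J"
    and u: "u \<in> {0..\<tau>}"
  shows "AE \<omega> in M. I u \<omega> = J u \<omega>"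
proof -
  have [measurable]: "I u \<in> borel_measurable M" "J u \<in> borel_measurable M"
    using I J u by (auto simp: is_forward_integral_def)
  have "AE \<omega> in M. \<bar>I u \<omega> - J u \<omega>\<bar> \<le> 2 * \<delta>" if "0 < \<delta>" for \<delta>
  proof -
    let ?E = "\<lambda>I \<epsilon>. {\<omega> \<in> space M. forward_error B \<phi> \<tau> I \<epsilon> \<omega> > ereal \<delta>}"
    have "((\<lambda>\<epsilon>. prob (?E I \<epsilon>)) \<longlongrightarrow> 0) (at_right 0)" "((\<lambda>\<epsilon>. prob (?E J \<epsilon>)) \<longlongrightarrow> 0) (at_right 0)"
      using I J that by (auto simp: is_forward_integral_def)
    then have "((\<lambda>\<epsilon>. prob (?E I \<epsilon>) + prob (?E J \<epsilon>)) \<longlongrightarrow> 0) (at_right 0)"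
      by (rule tendsto_add_zero)
    moreover have "\<forall>\<^sub>F \<epsilon> in at_right 0. \<P>(\<omega> in M. 2 * \<delta> < \<bar>I u \<omega> - J u \<omega>\<bar>) \<le> prob (?E I \<epsilon>) + prob (?E J \<epsilon>)"
    proof (rule eventually_at_rightI[of 0 1])
      fix \<epsilon> :: real assume \<epsilon>: "\<epsilon> \<in> {0<..<1}"
      then have [measurable]: "forward_error B \<phi> \<tau> I \<epsilon> \<in> borel_measurable M"
          "forward_error B \<phi> \<tau> J \<epsilon> \<in> borel_measurable M"
        using I J by (auto simp: is_forward_integral_def)
      have le: "ereal \<bar>forward_approx B \<phi> \<epsilon> u \<omega> - K u \<omega>\<bar> \<le> forward_error B \<phi> \<tau> K \<epsilon> \<omega>" for K \<omega>
        unfolding forward_error_def using u by (intro SUP_upper)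
      have "\<omega> \<in> ?E I \<epsilon> \<union> ?E J \<epsilon>" if "\<omega> \<in> space M" "2 * \<delta> < \<bar>I u \<omega> - J u \<omega>\<bar>" for \<omega>
      proof (rule ccontr)
        assume "\<omega> \<notin> ?E I \<epsilon> \<union> ?E J \<epsilon>"
        then have "forward_error B \<phi> \<tau> I \<epsilon> \<omega> \<le> ereal \<delta>" "forward_error B \<phi> \<tau> J \<epsilon> \<omega> \<le> ereal \<delta>"
          using that(1) by (simp_all add: not_less)
        then have "ereal \<bar>forward_approx B \<phi> \<epsilon> u \<omega> - I u \<omega>\<bar> \<le> ereal \<delta>"
            "ereal \<bar>forward_approx B \<phi> \<epsilon> u \<omega> - J u \<omega>\<bar> \<le> ereal \<delta>"
          by (auto intro!: order_trans[OF le] simp del: ereal_less_eq)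
        then show False
          using that(2) by simp
      qed
      then have "\<P>(\<omega> in M. 2 * \<delta> < \<bar>I u \<omega> - J u \<omega>\<bar>) \<le> prob (?E I \<epsilon> \<union> ?E J \<epsilon>)"
        by (intro finite_measure_mono) auto
      also have "\<dots> \<le> prob (?E I \<epsilon>) + prob (?E J \<epsilon>)"
        by (intro measure_Un_le) auto
      finally show "\<P>(\<omega> in M. 2 * \<delta> < \<bar>I u \<omega> - J u \<omega>\<bar>) \<le> prob (?E I \<epsilon>) + prob (?E J \<epsilon>)" .
    qed simp
    \<comment> \<open>The left side does not depend on \<open>\<epsilon>\<close>, so it is bounded
      by the limit of the right side.\<close>
    ultimately have "\<P>(\<omega> in M. 2 * \<delta> < \<bar>I u \<omega> - J u \<omega>\<bar>) \<le> 0"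
      by (intro tendsto_lowerbound) auto
    then have "\<P>(\<omega> in M. 2 * \<delta> < \<bar>I u \<omega> - J u \<omega>\<bar>) = 0"
      using measure_nonneg[of M "{\<omega> \<in> space M. 2 * \<delta> < \<bar>I u \<omega> - J u \<omega>\<bar>}"] by linarith
    then have "AE \<omega> in M. \<not> 2 * \<delta> < \<bar>I u \<omega> - J u \<omega>\<bar>"
      by (subst (asm) prob_eq_0) auto
    then show ?thesis
      by (auto simp: not_less)
  qed
  \<comment> \<open>The null set depends on \<open>\<delta>\<close>, so \<open>\<delta>\<close> is
    restricted to a sequence tending to 0.\<close>
  then have "AE \<omega> in M. \<forall>n::nat. \<bar>I u \<omega> - J u \<omega>\<bar> \<le> 2 * inverse (real (Suc n))"
    by (subst AE_all_countable) simp
  then show ?thesis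
  proof eventually_elim
    case (elim \<omega>)
    have "(\<lambda>n. 2 * inverse (real (Suc n))) \<longlonglongrightarrow> 2 * 0"
      by (intro tendsto_mult tendsto_const LIMSEQ_inverse_real_of_nat)
    then have "\<bar>I u \<omega> - J u \<omega>\<bar> \<le> 2 * 0"
      by (rule LIMSEQ_le_const) (use elim in auto)
    then show ?case by simp
  qed
qed

text \<open>The finite set depends only on the continuous limit, so it can be chosen before the random
  function \<open>A\<close>.\<close>

lemma mono_uniform_approximation:
  fixes G :: "real \<Rightarrow> real"
  assumes G: "continuous_on {0..t} G" and "0 < e"
  obtains D where "finite D" "D \<subseteq> {0..t}"
    and "\<And>A u. \<lbrakk>mono_on {0..t} A; \<And>d. d \<in> D \<Longrightarrow> \<bar>A d - G d\<bar> \<le> e / 2; u \<in> {0..t}\<rbrakk>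
      \<Longrightarrow> \<bar>A u - G u\<bar> \<le> (e :: real)"
proof -
  have "uniformly_continuous_on {0..t} G"
    using G by (intro compact_uniformly_continuous) auto
  then obtain h' where h': "0 < h'"
    "\<And>s v. \<lbrakk>s \<in> {0..t}; v \<in> {0..t}; dist v s < h'\<rbrakk> \<Longrightarrow> dist (G v) (G s) < e / 2"
    using assms(2) half_gt_zero unfolding uniformly_continuous_on_def by metis
  \<comment> \<open>Halving makes the mesh strictly smaller than \<open>h'\<close>. The grid stops
    at index \<open>Suc N\<close> because a point \<open>u\<close> with index
    \<open>i \<le> N\<close> also needs its right neighbour \<open>p (Suc i)\<close>.\<close>
  define h where "h = h' / 2"
  define p where "p i = min t (real i * h)" for i
  define N where "N = nat \<lceil>t / h\<rceil>"
  have h: "0 < h" "h < h'"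
    using h'(1) by (auto simp: h_def)
  show ?thesis
  proof (rule that)
    show "finite (p ` {..Suc N} \<inter> {0..t})" by simp
  next
    fix A u assume A: "mono_on {0..t} A" and u: "u \<in> {0..t}"
      and D: "\<And>d. d \<in> p ` {..Suc N} \<inter> {0..t} \<Longrightarrow> \<bar>A d - G d\<bar> \<le> e / 2"
    define i where "i = nat \<lfloor>u / h\<rfloor>"
    have i: "real i * h \<le> u" "u \<le> real (Suc i) * h"
    proof -
      have "real i = of_int \<lfloor>u / h\<rfloor>"
        using u h by (simp add: i_def)
      then have "real i \<le> u / h" "u / h \<le> real (Suc i)"
        by linarith+
      then show "real i * h \<le> u" "u \<le> real (Suc i) * h"
        using h by (simp_all add: pos_le_divide_eq pos_divide_le_eq)
    qed
    have "u / h \<le> t / h"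
      using u h by (intro divide_right_mono) auto
    then have "i \<le> N"
      unfolding i_def N_def by linarith
    then have "i \<in> {..Suc N}" "Suc i \<in> {..Suc N}"
      by auto
    moreover have pt: "p i \<in> {0..t}" "p (Suc i) \<in> {0..t}"
      using u h by (auto simp: p_def)
    ultimately have "\<bar>A (p i) - G (p i)\<bar> \<le> e / 2" "\<bar>A (p (Suc i)) - G (p (Suc i))\<bar> \<le> e / 2"
      using D by auto
    moreover have pu: "p i \<le> u" "u \<le> p (Suc i)" "u - p i < h'" "p (Suc i) - u < h'"
      using i u h by (auto simp: p_def algebra_simps min_def)
    then have "dist (G u) (G (p i)) < e / 2" "dist (G (p (Suc i))) (G u) < e / 2"
      using u pt by (intro h'(2); simp add: dist_real_def)+
    \<comment> \<open>Monotonicity squeezes \<open>A u\<close> between two grid values. On either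
      side the error is at most \<open>e / 2\<close> from \<open>A\<close> at the grid point plus
      \<open>e / 2\<close> from the oscillation of \<open>G\<close>.\<close>
    moreover have "A (p i) \<le> A u" "A u \<le> A (p (Suc i))"
      using pu pt u by (auto intro!: mono_onD[OF A])
    ultimately show "\<bar>A u - G u\<bar> \<le> e"
      unfolding dist_real_def by linarith
  qed simp
qed

section \<open>Moments and independence of Brownian increments\<close>

context standard_brownian_motion begin

lemma measurable_increment:
  assumes "0 \<le> s" "0 \<le> v"
  shows "(\<lambda>\<omega>. B v \<omega> - B s \<omega>) \<in> borel_measurable M"
  using measurable_B assms by measurable

lemma continuous_on_path:
  assumes "\<omega> \<in> space M" and "\<And>s. s \<in> S \<Longrightarrow> 0 \<le> f s" and "continuous_on S f"
  shows "continuous_on S (\<lambda>s. B (f s) \<omega>)"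
  using assms by (intro continuous_on_compose2[OF continuous_paths]) auto

text \<open>The factor is the double factorial (2k - 1)!!, the even moment of a standard normal
  variable: 1 for \<open>k = 1\<close> and 3 for \<open>k = 2\<close>.\<close>

lemma has_bochner_integral_increment_even_power:
  assumes "0 \<le> s" "s < u"
  shows "has_bochner_integral M (\<lambda>\<omega>. (B u \<omega> - B s \<omega>) ^ (2 * k))
    (fact (2 * k) / (2 ^ k * fact k) * (u - s) ^ k)"
proof -
  let ?f = "normal_density 0 (sqrt (u - s))"
  have D: "distributed M lborel (\<lambda>\<omega>. B u \<omega> - B s \<omega>) ?f"
    by (rule normal_increments[OF assms])
  have "has_bochner_integral lborel (\<lambda>x. ?f x * (x - 0) ^ (2 * k))
      (fact (2 * k) / ((2 / (sqrt (u - s))\<^sup>2) ^ k * fact k))"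
    using assms by (intro normal_moment_even) simp
  then have "has_bochner_integral lborel (\<lambda>x. ?f x * x ^ (2 * k))
      (fact (2 * k) / (2 ^ k * fact k) * (u - s) ^ k)"
    using assms by (simp add: power_divide)
  then show ?thesis
    using distributed_integral[OF D, of "\<lambda>x. x ^ (2 * k)"]
      distributed_integrable[OF D, of "\<lambda>x. x ^ (2 * k)"]
    by (simp add: has_bochner_integral_iff)
qed

lemma indep_increments:
  assumes "0 \<le> a" "a < b" "b \<le> c" "c < d"
  shows "indep_var borel (\<lambda>\<omega>. B b \<omega> - B a \<omega>) borel (\<lambda>\<omega>. B d \<omega> - B c \<omega>)"
\<comment> \<open>Partition points must increase strictly, so adjacent intervals need a partition of
  three points and separated ones a partition of four.\<close>
proof (cases "b = c")
  case True
  define p where "p i = (if i = 0 then a else if i = 1 then b else d)" for i :: nat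
  have "strict_mono_on {..2} p"
    using assms True by (auto simp: strict_mono_on_def p_def)
  moreover have "0 \<le> p 0"
    using assms by (simp add: p_def)
  ultimately have "indep_vars (\<lambda>_. borel) (\<lambda>i \<omega>. B (p (Suc i)) \<omega> - B (p i) \<omega>) {..<2}"
    by (intro independent_increments)
  then have "indep_vars (\<lambda>_. borel) (\<lambda>i \<omega>. B (p (Suc i)) \<omega> - B (p i) \<omega>) (insert 0 {1})"
    by (rule indep_vars_subset) auto
  \<comment> \<open>The rule makes the variable at index 0 independent of the sum over the other
    indices, here the single index 1.\<close>
  from indep_vars_sum[OF _ _ this] show ?thesis
    using True by (simp add: p_def)
next
  case False
  define p where "p i = (if i = 0 then a else if i = 1 then b else if i = 2 then c else d)" for i :: nat
  have "strict_mono_on {..3} p"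
    using assms False by (auto simp: strict_mono_on_def p_def)
  moreover have "0 \<le> p 0"
    using assms by (simp add: p_def)
  ultimately have "indep_vars (\<lambda>_. borel) (\<lambda>i \<omega>. B (p (Suc i)) \<omega> - B (p i) \<omega>) {..<3}"
    by (intro independent_increments)
  then have "indep_vars (\<lambda>_. borel) (\<lambda>i \<omega>. B (p (Suc i)) \<omega> - B (p i) \<omega>) (insert 0 {2})"
    by (rule indep_vars_subset) auto
  from indep_vars_sum[OF _ _ this] show ?thesis
    by (simp add: p_def)
qed

section \<open>Quadratic variation in mean square\<close>

text \<open>This is the integrand of the regularized quadratic variation at scale
  \<open>\<epsilon>\<close>.\<close>

definition scaled_square_increment :: "real \<Rightarrow> real \<Rightarrow> 'a \<Rightarrow> real" where
  "scaled_square_increment \<epsilon> s \<omega> = (B (s + \<epsilon>) \<omega> - B s \<omega>)\<^sup>2 / \<epsilon>"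

lemma scaled_square_increment_nonneg: "0 < \<epsilon> \<Longrightarrow> 0 \<le> scaled_square_increment \<epsilon> s \<omega>"
  by (simp add: scaled_square_increment_def)

lemma measurable_scaled_square_increment:
  "0 < \<epsilon> \<Longrightarrow> 0 \<le> s \<Longrightarrow> scaled_square_increment \<epsilon> s \<in> borel_measurable M"
  unfolding scaled_square_increment_def using measurable_increment[of s "s + \<epsilon>"] by measurable

lemma continuous_on_scaled_square_increment:
  assumes "\<omega> \<in> space M" "0 < \<epsilon>" "S \<subseteq> {0..}"
  shows "continuous_on S (\<lambda>s. scaled_square_increment \<epsilon> s \<omega>)"
  unfolding scaled_square_increment_def
  using assms by (intro continuous_intros continuous_on_path) auto

lemma scaled_square_increment_moments:
  assumes "0 < \<epsilon>" "0 \<le> s"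
  shows "has_bochner_integral M (scaled_square_increment \<epsilon> s) 1"
    and "has_bochner_integral M (\<lambda>\<omega>. (scaled_square_increment \<epsilon> s \<omega>)\<^sup>2) 3"
proof -
  note m = has_bochner_integral_increment_even_power[of s "s + \<epsilon>"]
  show "has_bochner_integral M (scaled_square_increment \<epsilon> s) 1"
    using has_bochner_integral_divide_zero[OF m[of 1], of \<epsilon>] assms
    by (simp add: scaled_square_increment_def[abs_def] fact_numeral)
  show "has_bochner_integral M (\<lambda>\<omega>. (scaled_square_increment \<epsilon> s \<omega>)\<^sup>2) 3"
    using has_bochner_integral_divide_zero[OF m[of 2], of "\<epsilon>\<^sup>2"] assms
    by (simp add: scaled_square_increment_def fact_numeral power_divide power2_eq_square power4_eq_xxxx mult_ac)
qed

text \<open>The bound 3 comes from 2xy <= x^2 + y^2 and the fourth moment of the increments. For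
  times more than \<open>\<epsilon>\<close> apart the increments belong to disjoint intervals, and
  the expectation factors.\<close>

lemma scaled_square_increment_product:
  assumes "0 < \<epsilon>" "0 \<le> s" "0 \<le> v"
  shows "integrable M (\<lambda>\<omega>. scaled_square_increment \<epsilon> s \<omega> * scaled_square_increment \<epsilon> v \<omega>)"
    and "expectation (\<lambda>\<omega>. scaled_square_increment \<epsilon> s \<omega> * scaled_square_increment \<epsilon> v \<omega>) \<le> 3"
    and "\<epsilon> < \<bar>s - v\<bar> \<Longrightarrow>
      expectation (\<lambda>\<omega>. scaled_square_increment \<epsilon> s \<omega> * scaled_square_increment \<epsilon> v \<omega>) = 1"
proof -
  let ?Q = "scaled_square_increment \<epsilon>"
  have le: "?Q s \<omega> * ?Q v \<omega> \<le> ((?Q s \<omega>)\<^sup>2 + (?Q v \<omega>)\<^sup>2) / 2" for \<omega>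
    using sum_squares_bound[of "?Q s \<omega>" "?Q v \<omega>"] by simp
  note m = scaled_square_increment_moments[OF assms(1)]
  have sq: "has_bochner_integral M (\<lambda>\<omega>. ((?Q s \<omega>)\<^sup>2 + (?Q v \<omega>)\<^sup>2) / 2) 3"
    using has_bochner_integral_divide_zero[OF has_bochner_integral_add[OF m(2)[of s] m(2)[of v]], of 2]
      assms by simp
  show i: "integrable M (\<lambda>\<omega>. ?Q s \<omega> * ?Q v \<omega>)"
    using le scaled_square_increment_nonneg[OF assms(1)] measurable_scaled_square_increment assms
    by (intro Bochner_Integration.integrable_bound[OF sq[THEN integrable.intros]]) auto
  show "expectation (\<lambda>\<omega>. ?Q s \<omega> * ?Q v \<omega>) \<le> 3"
    using integral_mono[OF i _ le] sq by (simp add: has_bochner_integral_iff)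
  have one: "expectation (\<lambda>\<omega>. ?Q a \<omega> * ?Q b \<omega>) = 1" if "0 \<le> a" "a + \<epsilon> < b" for a b
  proof -
    have "indep_var borel (\<lambda>\<omega>. B (a + \<epsilon>) \<omega> - B a \<omega>) borel (\<lambda>\<omega>. B (b + \<epsilon>) \<omega> - B b \<omega>)"
      using that assms by (intro indep_increments) auto
    from indep_var_compose[OF this, of "\<lambda>x. x\<^sup>2 / \<epsilon>" borel "\<lambda>x. x\<^sup>2 / \<epsilon>" borel]
    have "indep_var borel (?Q a) borel (?Q b)"
      by (simp add: o_def scaled_square_increment_def[abs_def])
    then show ?thesis
      using m(1)[of a] m(1)[of b] that assms
      by (subst indep_var_lebesgue_integral) (auto simp: has_bochner_integral_iff)
  qed
  show "expectation (\<lambda>\<omega>. ?Q s \<omega> * ?Q v \<omega>) = 1" if "\<epsilon> < \<bar>s - v\<bar>"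
    using one[of s v] one[of v s] that assms by (cases "s < v") (auto simp: mult.commute)
qed

text \<open>By Fubini the second moment is the double integral of \<open>g s * g v\<close> times the
  expected product of scaled squares. That expectation is 1 away from the diagonal, which yields the
  square of the mean; the strip around the diagonal has area of order \<open>\<epsilon>\<close> and
  bounds the variance.\<close>

lemma quadratic_variation_second_moment:
  assumes \<epsilon>: "0 < \<epsilon>" and u: "0 \<le> u" and g: "continuous_on {0..u} g"
    and bound: "\<forall>s\<in>{0..u}. 0 \<le> g s \<and> g s \<le> C"
  shows "expectation (\<lambda>\<omega>. LINT s:{0..u}|lborel. g s * scaled_square_increment \<epsilon> s \<omega>) =
      (LINT s:{0..u}|lborel. g s)"
    and "integrable M (\<lambda>\<omega>. (LINT s:{0..u}|lborel. g s * scaled_square_increment \<epsilon> s \<omega>)\<^sup>2)"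
    and "variance (\<lambda>\<omega>. LINT s:{0..u}|lborel. g s * scaled_square_increment \<epsilon> s \<omega>) \<le> 4 * C\<^sup>2 * u * \<epsilon>"
proof -
  let ?Q = "scaled_square_increment \<epsilon>"
  \<comment> \<open>Cutting off with indicators extends the integrands to the whole line. They are
    nonnegative, so Fubini applies to \<open>nn_integral\<close> before any integrability is
    known.\<close>
  define a where "a s = indicator {0..u} s * g s" for s
  define k where "k s \<omega> = indicator {0..u} s * (g s * ?Q s \<omega>)" for s \<omega>
  define G where "G = (LINT s:{0..u}|lborel. g s)"
  define A where "A \<omega> = (LINT s:{0..u}|lborel. g s * ?Q s \<omega>)" for \<omega>
  interpret P: pair_sigma_finite lborel M ..
  note C = bspec[OF bound]
  have C0: "0 \<le> C"
    using C[of 0] u by auto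
  have a0: "0 \<le> a s" and aC: "a s \<le> C * indicator {0..u} s" and k0: "0 \<le> k s \<omega>" for s \<omega>
    using C[of s] scaled_square_increment_nonneg[OF \<epsilon>] by (auto simp: a_def k_def indicator_def)
  have cont: "continuous_on {0..u} (\<lambda>s. g s * ?Q s \<omega>)" if "\<omega> \<in> space M" for \<omega>
    using that \<epsilon> by (intro continuous_intros g continuous_on_scaled_square_increment) auto
  have meas: "(\<lambda>\<omega>. g s * ?Q s \<omega>) \<in> borel_measurable M" if "s \<in> {0..u}" for s
    using that \<epsilon> by (intro borel_measurable_times borel_measurable_const measurable_scaled_square_increment) auto
  have k_pair: "(\<lambda>x. k (fst x) (snd x)) \<in> borel_measurable (borel \<Otimes>\<^sub>M M)"
    using borel_measurable_continuous_process[OF u meas cont] by (simp add: k_def)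
  have k_meas[measurable (raw)]: "(\<lambda>x. k (f x) (h x)) \<in> borel_measurable N"
    if "f \<in> borel_measurable N" "h \<in> measurable N M" for f h and N :: "'c measure"
    using measurable_compose[OF measurable_Pair[OF that] k_pair] by simp
  have a_int: "integrable lborel a"
    using borel_integrable_atLeastAtMost'[OF g] by (simp add: a_def[abs_def] set_integrable_def)
  then have [measurable]: "a \<in> borel_measurable borel" by auto
  have G: "(\<integral>\<^sup>+s. ennreal (a s) \<partial>lborel) = ennreal G"
    using a_int a0 by (subst nn_integral_eq_integral) (auto simp: a_def[abs_def] G_def set_lebesgue_integral_def)
  have G0: "0 \<le> G"
    using a0 by (auto simp: G_def a_def set_lebesgue_integral_def intro!: integral_nonneg)
  have A: "ennreal (A \<omega>) = (\<integral>\<^sup>+s. ennreal (k s \<omega>) \<partial>lborel)" if "\<omega> \<in> space M" for \<omega>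
    using k0 borel_integrable_atLeastAtMost'[OF cont[OF that]]
    by (subst nn_integral_eq_integral) (auto simp: A_def k_def set_lebesgue_integral_def set_integrable_def)
  have A0: "0 \<le> A \<omega>" for \<omega>
    using k0 by (auto simp: A_def k_def set_lebesgue_integral_def intro!: integral_nonneg)
  have A_meas[measurable]: "A \<in> borel_measurable M"
    unfolding A_def by (rule borel_measurable_set_integral_continuous[OF u meas cont])
  note Q1 = scaled_square_increment_moments(1)[OF \<epsilon>, unfolded has_bochner_integral_iff]
  have Ek: "(\<integral>\<^sup>+\<omega>. ennreal (k s \<omega>) \<partial>M) = ennreal (a s)" for s
    using Q1[of s] C[of s] scaled_square_increment_nonneg[OF \<epsilon>]
    by (subst nn_integral_eq_integral) (auto simp: k_def[abs_def] a_def indicator_def)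
  have "(\<integral>\<^sup>+\<omega>. ennreal (A \<omega>) \<partial>M) = (\<integral>\<^sup>+\<omega>. \<integral>\<^sup>+s. ennreal (k s \<omega>) \<partial>lborel \<partial>M)"
    by (intro nn_integral_cong A)
  also have "\<dots> = (\<integral>\<^sup>+s. \<integral>\<^sup>+\<omega>. ennreal (k s \<omega>) \<partial>M \<partial>lborel)"
    by (rule P.Fubini') measurable
  also have "\<dots> = ennreal G"
    by (simp add: Ek G)
  finally have nnA: "(\<integral>\<^sup>+\<omega>. ennreal (A \<omega>) \<partial>M) = ennreal G" .
  then have expA: "expectation A = G"
    using A0 G0 by (subst integral_eq_nn_integral) auto
  \<comment> \<open>\<open>m\<close> is the diagonal excess: in the strip the expected product is at
    most 3 instead of 1, and the weights multiply to at most \<open>C\<^sup>2\<close>. The strip has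
    width \<open>2 * \<epsilon>\<close> at each \<open>s\<close>, so \<open>m\<close> integrates to
    \<open>4 * C\<^sup>2 * u * \<epsilon>\<close>.\<close>
  define m where "m s v = 2 * C\<^sup>2 * (indicator {0..u} s * indicator {s - \<epsilon>..s + \<epsilon>} v)" for s v :: real
  have Ekk: "(\<integral>\<^sup>+\<omega>. ennreal (k s \<omega>) * ennreal (k v \<omega>) \<partial>M) \<le> ennreal (a s) * ennreal (a v) + ennreal (m s v)" for s v
  proof (cases "s \<in> {0..u} \<and> v \<in> {0..u}")
    case True
    note prod = scaled_square_increment_product[OF \<epsilon>, of s v]
    have kk: "k s \<omega> * k v \<omega> = (a s * a v) * (?Q s \<omega> * ?Q v \<omega>)" for \<omega>
      by (simp add: k_def a_def)
    have "(\<integral>\<^sup>+\<omega>. ennreal (k s \<omega>) * ennreal (k v \<omega>) \<partial>M) = (\<integral>\<^sup>+\<omega>. ennreal ((a s * a v) * (?Q s \<omega> * ?Q v \<omega>)) \<partial>M)"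
      using k0 by (simp add: ennreal_mult[symmetric] kk)
    also have "\<dots> = ennreal ((a s * a v) * expectation (\<lambda>\<omega>. ?Q s \<omega> * ?Q v \<omega>))"
      using True prod(1) a0 scaled_square_increment_nonneg[OF \<epsilon>]
      by (subst nn_integral_eq_integral) auto
    also have "\<dots> \<le> ennreal (a s * a v + m s v)"
    proof (rule ennreal_leI, cases "\<epsilon> < \<bar>s - v\<bar>")
      assume "\<epsilon> < \<bar>s - v\<bar>"
      then show "(a s * a v) * expectation (\<lambda>\<omega>. ?Q s \<omega> * ?Q v \<omega>) \<le> a s * a v + m s v"
        using True prod(3) by (auto simp: m_def)
    next
      assume "\<not> \<epsilon> < \<bar>s - v\<bar>"
      then have "m s v = 2 * C\<^sup>2"
        using True by (auto simp: m_def indicator_def)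
      moreover have "(a s * a v) * expectation (\<lambda>\<omega>. ?Q s \<omega> * ?Q v \<omega>) \<le> (a s * a v) * 3"
        using True prod(2) a0 by (intro mult_left_mono) auto
      moreover have "a s * a v \<le> C\<^sup>2"
        unfolding power2_eq_square using aC[of s] aC[of v] a0 C0 True by (intro mult_mono) auto
      ultimately show "(a s * a v) * expectation (\<lambda>\<omega>. ?Q s \<omega> * ?Q v \<omega>) \<le> a s * a v + m s v"
        by linarith
    qed
    also have "\<dots> = ennreal (a s) * ennreal (a v) + ennreal (m s v)"
      using a0 C0 by (simp add: ennreal_mult ennreal_plus m_def)
    finally show ?thesis .
  qed (auto simp: k_def)
  have A2: "ennreal ((A \<omega>)\<^sup>2) = (\<integral>\<^sup>+s. \<integral>\<^sup>+v. ennreal (k s \<omega>) * ennreal (k v \<omega>) \<partial>lborel \<partial>lborel)"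
    if \<omega>: "\<omega> \<in> space M" for \<omega>
  proof -
    have [measurable]: "(\<lambda>s. k s \<omega>) \<in> borel_measurable borel"
      using \<omega> by measurable
    show ?thesis
      using A0 by (simp add: nn_integral_cmult nn_integral_multc A[OF \<omega>, symmetric] power2_eq_square ennreal_mult)
  qed
  have "(\<integral>\<^sup>+\<omega>. ennreal ((A \<omega>)\<^sup>2) \<partial>M) =
      (\<integral>\<^sup>+\<omega>. \<integral>\<^sup>+s. \<integral>\<^sup>+v. ennreal (k s \<omega>) * ennreal (k v \<omega>) \<partial>lborel \<partial>lborel \<partial>M)"
    by (intro nn_integral_cong A2)
  also have "\<dots> = (\<integral>\<^sup>+s. \<integral>\<^sup>+\<omega>. \<integral>\<^sup>+v. ennreal (k s \<omega>) * ennreal (k v \<omega>) \<partial>lborel \<partial>M \<partial>lborel)"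
    by (rule P.Fubini') measurable
  also have "\<dots> = (\<integral>\<^sup>+s. \<integral>\<^sup>+v. \<integral>\<^sup>+\<omega>. ennreal (k s \<omega>) * ennreal (k v \<omega>) \<partial>M \<partial>lborel \<partial>lborel)"
    by (intro nn_integral_cong P.Fubini') measurable
  also have "\<dots> \<le> (\<integral>\<^sup>+s. \<integral>\<^sup>+v. ennreal (a s) * ennreal (a v) + ennreal (m s v) \<partial>lborel \<partial>lborel)"
    by (intro nn_integral_mono Ekk)
  also have "\<dots> = (\<integral>\<^sup>+s. ennreal (a s) * ennreal G + (\<integral>\<^sup>+v. ennreal (m s v) \<partial>lborel) \<partial>lborel)"
    unfolding m_def by (intro nn_integral_cong) (simp add: nn_integral_add nn_integral_cmult G)
  also have "(\<lambda>s. \<integral>\<^sup>+v. ennreal (m s v) \<partial>lborel) = (\<lambda>s. ennreal (4 * C\<^sup>2 * \<epsilon>) * indicator {0..u} s)"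
  proof
    fix s
    have "ennreal (m s v) = (ennreal (2 * C\<^sup>2) * indicator {0..u} s) * indicator {s - \<epsilon>..s + \<epsilon>} v" for v
      by (auto simp: m_def indicator_def)
    then have "(\<integral>\<^sup>+v. ennreal (m s v) \<partial>lborel) = ennreal (2 * C\<^sup>2) * indicator {0..u} s * ennreal (2 * \<epsilon>)"
      using \<epsilon> by (simp add: nn_integral_cmult)
    also have "\<dots> = (ennreal (2 * C\<^sup>2) * ennreal (2 * \<epsilon>)) * indicator {0..u} s"
      by (simp add: mult_ac)
    also have "ennreal (2 * C\<^sup>2) * ennreal (2 * \<epsilon>) = ennreal (4 * C\<^sup>2 * \<epsilon>)"
      using \<epsilon> by (subst ennreal_mult[symmetric]) (auto simp: mult_ac)
    finally show "(\<integral>\<^sup>+v. ennreal (m s v) \<partial>lborel) = ennreal (4 * C\<^sup>2 * \<epsilon>) * indicator {0..u} s" .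
  qed
  also have "(\<integral>\<^sup>+s. ennreal (a s) * ennreal G + ennreal (4 * C\<^sup>2 * \<epsilon>) * indicator {0..u} s \<partial>lborel) =
      ennreal G * ennreal G + ennreal (4 * C\<^sup>2 * \<epsilon>) * ennreal u"
    using u by (simp add: nn_integral_add nn_integral_multc nn_integral_cmult G)
  also have "\<dots> = ennreal (G\<^sup>2 + 4 * C\<^sup>2 * u * \<epsilon>)"
    using G0 C0 u \<epsilon> by (simp add: ennreal_mult[symmetric] ennreal_plus[symmetric] power2_eq_square mult_ac del: ennreal_plus)
  finally have nnA2: "(\<integral>\<^sup>+\<omega>. ennreal ((A \<omega>)\<^sup>2) \<partial>M) \<le> ennreal (G\<^sup>2 + 4 * C\<^sup>2 * u * \<epsilon>)" .
  have int2: "integrable M (\<lambda>\<omega>. (A \<omega>)\<^sup>2)"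
    using nnA2 by (intro integrableI_nonneg) (auto simp: less_top[symmetric] top_unique)
  have int1: "integrable M A"
    using nnA A0 by (intro integrableI_nonneg) auto
  have "ennreal (expectation (\<lambda>\<omega>. (A \<omega>)\<^sup>2)) \<le> ennreal (G\<^sup>2 + 4 * C\<^sup>2 * u * \<epsilon>)"
    using nnA2 int2 by (subst (asm) nn_integral_eq_integral) auto
  then have exp2: "expectation (\<lambda>\<omega>. (A \<omega>)\<^sup>2) \<le> G\<^sup>2 + 4 * C\<^sup>2 * u * \<epsilon>"
    using u \<epsilon> by (subst (asm) ennreal_le_iff) auto
  show "expectation (\<lambda>\<omega>. LINT s:{0..u}|lborel. g s * ?Q s \<omega>) = (LINT s:{0..u}|lborel. g s)"
    using expA by (simp add: A_def[abs_def] G_def)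
  show "integrable M (\<lambda>\<omega>. (LINT s:{0..u}|lborel. g s * ?Q s \<omega>)\<^sup>2)"
    using int2 by (simp add: A_def)
  have "variance A \<le> 4 * C\<^sup>2 * u * \<epsilon>"
    using exp2 variance_eq[OF int1 int2] expA by simp
  then show "variance (\<lambda>\<omega>. LINT s:{0..u}|lborel. g s * ?Q s \<omega>) \<le> 4 * C\<^sup>2 * u * \<epsilon>"
    by (simp add: A_def[abs_def])
qed

lemma measurable_quadratic_variation:
  assumes "0 < \<epsilon>" "0 \<le> u" "continuous_on {0..u} g"
  shows "(\<lambda>\<omega>. LINT s:{0..u}|lborel. g s * scaled_square_increment \<epsilon> s \<omega>) \<in> borel_measurable M"
  using assms by (intro borel_measurable_set_integral_continuous continuous_intros
    continuous_on_scaled_square_increment borel_measurable_times borel_measurable_const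
    measurable_scaled_square_increment) auto

lemma prob_quadratic_variation_deviation_le:
  assumes "0 < \<epsilon>" "0 \<le> u" "continuous_on {0..u} g"
    and "\<forall>s\<in>{0..u}. 0 \<le> g s \<and> g s \<le> C" and "0 < \<delta>"
  shows "\<P>(\<omega> in M. \<delta> \<le> \<bar>(LINT s:{0..u}|lborel. g s * scaled_square_increment \<epsilon> s \<omega>) -
      (LINT s:{0..u}|lborel. g s)\<bar>) \<le> 4 * C\<^sup>2 * u * \<epsilon> / \<delta>\<^sup>2"
proof -
  note m = quadratic_variation_second_moment[OF assms(1-4)]
  note Chebyshev_inequality[OF measurable_quadratic_variation[OF assms(1-3)] m(2) assms(5)]
  also have "variance (\<lambda>\<omega>. LINT s:{0..u}|lborel. g s * scaled_square_increment \<epsilon> s \<omega>) / \<delta>\<^sup>2 \<le>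
      4 * C\<^sup>2 * u * \<epsilon> / \<delta>\<^sup>2"
    using m(3) by (intro divide_right_mono) auto
  finally show ?thesis
    unfolding m(1) .
qed

section \<open>An explicit forward integral of an anticipating integrand\<close>

text \<open>With Y s = B T - B s, this is half of the integral of \<open>g\<close> against ds minus
  half of the integral of \<open>g\<close> against d(Y^2), the latter written out by integration by
  parts.\<close>

definition future_increment_integral ::
    "real \<Rightarrow> (real \<Rightarrow> real) \<Rightarrow> (real \<Rightarrow> real) \<Rightarrow> real \<Rightarrow> 'a \<Rightarrow> real" where
  "future_increment_integral T g g' u \<omega> =
     (g 0 * (B T \<omega> - B 0 \<omega>)\<^sup>2 - g u * (B T \<omega> - B u \<omega>)\<^sup>2 +
      (LINT s:{0..u}|lborel. g' s * (B T \<omega> - B s \<omega>)\<^sup>2) + (LINT s:{0..u}|lborel. g s)) / 2"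

text \<open>The error splits into a pathwise part, uniformly small for small
  \<open>\<epsilon>\<close>, and a quadratic variation part controlled only in probability and at
  fixed times. Since \<open>g\<close> is nonnegative, the latter is monotone in \<open>u\<close>
  before the limit, so finitely many times give uniformity.\<close>

lemma is_forward_integral_future_increment:
  fixes g g' :: "real \<Rightarrow> real"
  assumes T: "0 \<le> T" and t: "0 \<le> t"
    and g_nonneg: "\<And>s. s \<in> {0..t} \<Longrightarrow> 0 \<le> g s"
    and g: "\<And>s. s \<in> {0..t} \<Longrightarrow> (g has_real_derivative g' s) (at s within {0..t})"
    and g': "continuous_on {0..t} g'"
  shows "is_forward_integral M B (\<lambda>s \<omega>. g s * (B T \<omega> - B s \<omega>)) t (future_increment_integral T g g')"
proof -
  let ?\<phi> = "\<lambda>s \<omega>. g s * (B T \<omega> - B s \<omega>)"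
  let ?I = "future_increment_integral T g g'"
  define A where "A \<epsilon> u \<omega> = (LINT s:{0..u}|lborel. g s * scaled_square_increment \<epsilon> s \<omega>)" for \<epsilon> u \<omega>
  define G where "G u = (LINT s:{0..u}|lborel. g s)" for u
  define y where "y \<omega> s = (B T \<omega> - B s \<omega>)\<^sup>2" for \<omega> s
  define R\<epsilon> where "R\<epsilon> \<epsilon> u \<omega> = integral {0..u} (\<lambda>s. g s * ((y \<omega> s - y \<omega> (s + \<epsilon>)) / \<epsilon>))" for \<epsilon> u \<omega>
  define R where "R u \<omega> = g 0 * y \<omega> 0 - g u * y \<omega> u + integral {0..u} (\<lambda>s. g' s * y \<omega> s)" for u \<omega>
  have contg: "continuous_on {0..t} g"
    using g by (rule DERIV_continuous_on)
  have contg_u: "continuous_on {0..u} g" "continuous_on {0..u} g'" if "u \<in> {0..t}" for u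
    using that by (auto intro: continuous_on_subset[OF contg] continuous_on_subset[OF g'])
  have conty: "continuous_on S (y \<omega>)" if "\<omega> \<in> space M" "S \<subseteq> {0..}" for \<omega> S
    unfolding y_def using that by (intro continuous_intros continuous_on_path) auto
  have cont_integrand: "continuous_on {0..t} (\<lambda>s. ?\<phi> s \<omega> * ((B (s + \<epsilon>) \<omega> - B s \<omega>) / \<epsilon>))"
    if "\<omega> \<in> space M" "0 < \<epsilon>" for \<omega> \<epsilon>
    using that by (intro continuous_intros contg continuous_on_path) auto
  have I_meas: "?I u \<in> borel_measurable M" if "u \<in> {0..t}" for u
  proof -
    have [measurable]: "(\<lambda>\<omega>. LINT s:{0..u}|lborel. g' s * (B T \<omega> - B s \<omega>)\<^sup>2) \<in> borel_measurable M"
      using that T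
      by (intro borel_measurable_set_integral_continuous continuous_intros contg_u continuous_on_path)
        (auto intro!: borel_measurable_times borel_measurable_power borel_measurable_diff measurable_B)
    have [measurable]: "B T \<in> borel_measurable M" "B u \<in> borel_measurable M" "B 0 \<in> borel_measurable M"
      using that T by (auto intro: measurable_B)
    show ?thesis
      unfolding future_increment_integral_def[abs_def] by measurable
  qed
  have I_cont: "continuous_on {0..t} (\<lambda>u. ?I u \<omega>)" if "\<omega> \<in> space M" for \<omega>
    unfolding future_increment_integral_def using that
    by (intro continuous_intros continuous_on_set_integral contg g' continuous_on_path) auto
  have approx_meas: "forward_approx B ?\<phi> \<epsilon> u \<in> borel_measurable M" if "u \<in> {0..t}" "0 < \<epsilon>" for u \<epsilon>
    unfolding forward_approx_def[abs_def]
  proof (rule borel_measurable_set_integral_continuous)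
    show "continuous_on {0..u} (\<lambda>s. ?\<phi> s \<omega> * ((B (s + \<epsilon>) \<omega> - B s \<omega>) / \<epsilon>))" if "\<omega> \<in> space M" for \<omega>
      by (rule continuous_on_subset[OF cont_integrand[OF that \<open>0 < \<epsilon>\<close>]]) (use \<open>u \<in> {0..t}\<close> in auto)
    show "(\<lambda>\<omega>. ?\<phi> s \<omega> * ((B (s + \<epsilon>) \<omega> - B s \<omega>) / \<epsilon>)) \<in> borel_measurable M" if "s \<in> {0..u}" for s
    proof -
      have [measurable]: "B T \<in> borel_measurable M" "B s \<in> borel_measurable M" "B (s + \<epsilon>) \<in> borel_measurable M"
        using that T \<open>0 < \<epsilon>\<close> by (auto intro: measurable_B)
      show ?thesis by measurable
    qed
  qed (use that in auto)
  have approx_cont: "continuous_on {0..t} (\<lambda>u. forward_approx B ?\<phi> \<epsilon> u \<omega>)"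
    if "\<omega> \<in> space M" "0 < \<epsilon>" for \<omega> \<epsilon>
    unfolding forward_approx_def by (intro continuous_on_set_integral cont_integrand that)
  have err_meas: "forward_error B ?\<phi> t ?I \<epsilon> \<in> borel_measurable M" if "0 < \<epsilon>" for \<epsilon>
    unfolding forward_error_def[abs_def] using that
    by (intro borel_measurable_SUP_continuous continuous_intros approx_cont I_cont
        borel_measurable_abs borel_measurable_diff approx_meas I_meas) auto
  have err_eq: "forward_approx B ?\<phi> \<epsilon> u \<omega> - ?I u \<omega> = (R\<epsilon> \<epsilon> u \<omega> - R u \<omega>) / 2 + (A \<epsilon> u \<omega> - G u) / 2"
    if \<omega>: "\<omega> \<in> space M" and \<epsilon>: "0 < \<epsilon>" and u: "u \<in> {0..t}" for \<omega> \<epsilon> u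
  proof -
    have c1: "continuous_on {0..u} (\<lambda>s. g s * ((y \<omega> s - y \<omega> (s + \<epsilon>)) / \<epsilon>))"
      unfolding y_def using \<omega> \<epsilon> by (intro continuous_intros contg_u u continuous_on_path) auto
    have c2: "continuous_on {0..u} (\<lambda>s. g s * scaled_square_increment \<epsilon> s \<omega>)"
      using \<omega> \<epsilon> by (intro continuous_intros contg_u u continuous_on_scaled_square_increment) auto
    have c3: "continuous_on {0..u} (\<lambda>s. g' s * y \<omega> s)"
      using \<omega> by (intro continuous_intros contg_u u conty) auto
    note int = borel_integrable_atLeastAtMost'[OF c1] borel_integrable_atLeastAtMost'[OF c2]
    have polarization: "?\<phi> s \<omega> * ((B (s + \<epsilon>) \<omega> - B s \<omega>) / \<epsilon>) =
        (g s * ((y \<omega> s - y \<omega> (s + \<epsilon>)) / \<epsilon>) + g s * scaled_square_increment \<epsilon> s \<omega>) / 2" for s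
      using \<epsilon> by (simp add: y_def scaled_square_increment_def field_simps power2_eq_square)
    have "forward_approx B ?\<phi> \<epsilon> u \<omega> =
        ((LINT s:{0..u}|lborel. g s * ((y \<omega> s - y \<omega> (s + \<epsilon>)) / \<epsilon>)) + A \<epsilon> u \<omega>) / 2"
      unfolding forward_approx_def polarization A_def
      by (subst set_integral_add(2)[OF int, symmetric]) simp
    also have "(LINT s:{0..u}|lborel. g s * ((y \<omega> s - y \<omega> (s + \<epsilon>)) / \<epsilon>)) = R\<epsilon> \<epsilon> u \<omega>"
      unfolding R\<epsilon>_def by (rule set_borel_integral_eq_integral(2)[OF int(1)])
    finally show ?thesis
      using set_borel_integral_eq_integral(2)[OF borel_integrable_atLeastAtMost'[OF c3]]
      by (simp add: future_increment_integral_def R_def G_def y_def field_simps)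
  qed
  have "((\<lambda>\<epsilon>. \<P>(\<omega> in M. forward_error B ?\<phi> t ?I \<epsilon> \<omega> > ereal \<delta>)) \<longlongrightarrow> 0) (at_right 0)"
    if \<delta>: "0 < \<delta>" for \<delta>
  proof -
    have "continuous_on {0..t} G"
      unfolding G_def by (rule continuous_on_set_integral[OF contg])
    then obtain D where D: "finite D" "D \<subseteq> {0..t}"
      and unif: "\<And>A u. \<lbrakk>mono_on {0..t} A; \<And>d. d \<in> D \<Longrightarrow> \<bar>A d - G d\<bar> \<le> \<delta> / 2; u \<in> {0..t}\<rbrakk>
        \<Longrightarrow> \<bar>A u - G u\<bar> \<le> \<delta>"
      using mono_uniform_approximation[OF _ \<delta>] by metis
    have "bounded (g ` {0..t})"
      by (intro compact_imp_bounded compact_continuous_image contg compact_Icc)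
    then obtain C where C: "\<And>s. s \<in> {0..t} \<Longrightarrow> \<bar>g s\<bar> \<le> C"
      unfolding bounded_iff real_norm_def by blast
    \<comment> \<open>\<open>E\<close> is the bad event and \<open>F\<close> collects the deviations
      of the quadratic variation at the times in \<open>D\<close>. Each path eventually leaves
      \<open>E\<close> minus the union of the \<open>F\<close>, while Chebyshev's inequality makes
      the probability of that union of order \<open>\<epsilon>\<close>.\<close>
    define E where "E \<epsilon> = {\<omega> \<in> space M. forward_error B ?\<phi> t ?I \<epsilon> \<omega> > ereal \<delta>}" for \<epsilon>
    define F where "F \<epsilon> d = {\<omega> \<in> space M. \<delta> / 2 \<le> \<bar>A \<epsilon> d \<omega> - G d\<bar>}" for \<epsilon> d
    have E_sets: "E \<epsilon> \<in> events" if "0 < \<epsilon>" for \<epsilon>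
      unfolding E_def using err_meas[OF that] by measurable
    have F_sets: "F \<epsilon> d \<in> events" if "0 < \<epsilon>" "d \<in> D" for \<epsilon> d
    proof -
      have [measurable]: "A \<epsilon> d \<in> borel_measurable M"
        unfolding A_def using that D(2) by (intro measurable_quadratic_variation contg_u) auto
      show ?thesis unfolding F_def by measurable
    qed
    have A_mono: "mono_on {0..t} (\<lambda>u. A \<epsilon> u \<omega>)" if "\<omega> \<in> space M" "0 < \<epsilon>" for \<omega> \<epsilon>
    proof (rule mono_onI)
      fix u v assume uv: "u \<in> {0..t}" "v \<in> {0..t}" "u \<le> v"
      have "set_integrable lborel {0..w} (\<lambda>s. g s * scaled_square_increment \<epsilon> s \<omega>)" if "w \<in> {0..t}" for w
        using that \<open>\<omega> \<in> space M\<close> \<open>0 < \<epsilon>\<close>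
        by (intro borel_integrable_atLeastAtMost' continuous_intros contg_u continuous_on_scaled_square_increment) auto
      then show "A \<epsilon> u \<omega> \<le> A \<epsilon> v \<omega>"
        unfolding A_def set_lebesgue_integral_def set_integrable_def
        using uv g_nonneg scaled_square_increment_nonneg[OF \<open>0 < \<epsilon>\<close>]
        by (intro integral_mono) (auto simp: indicator_def)
    qed
    have "((\<lambda>\<epsilon>. prob (E \<epsilon> - (\<Union>d\<in>D. F \<epsilon> d))) \<longlongrightarrow> 0) (at_right 0)"
    proof (rule tendsto_prob_0_at_right)
      show "E \<epsilon> - (\<Union>d\<in>D. F \<epsilon> d) \<in> events" if "0 < \<epsilon>" for \<epsilon>
        using that D(1) by (intro sets.Diff sets.finite_UN E_sets F_sets)
      fix \<omega> assume \<omega>: "\<omega> \<in> space M"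
      have "\<forall>\<^sub>F \<epsilon> in at_right 0. \<forall>u\<in>{0..t}. \<bar>R\<epsilon> \<epsilon> u \<omega> - R u \<omega>\<bar> \<le> \<delta>"
        unfolding R\<epsilon>_def R_def
        by (rule eventually_integral_shifted_difference[OF t conty[OF \<omega> order_refl] g g' \<delta>])
      then show "\<forall>\<^sub>F \<epsilon> in at_right 0. \<omega> \<notin> E \<epsilon> - (\<Union>d\<in>D. F \<epsilon> d)"
        using eventually_at_right_less[of "0::real"]
      proof eventually_elim
        fix \<epsilon> :: real assume R: "\<forall>u\<in>{0..t}. \<bar>R\<epsilon> \<epsilon> u \<omega> - R u \<omega>\<bar> \<le> \<delta>" and \<epsilon>: "0 < \<epsilon>"
        show "\<omega> \<notin> E \<epsilon> - (\<Union>d\<in>D. F \<epsilon> d)"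
        proof
          assume "\<omega> \<in> E \<epsilon> - (\<Union>d\<in>D. F \<epsilon> d)"
          then have E: "\<omega> \<in> E \<epsilon>" and "\<And>d. d \<in> D \<Longrightarrow> \<bar>A \<epsilon> d \<omega> - G d\<bar> \<le> \<delta> / 2"
            using \<omega> by (auto simp: F_def not_le less_imp_le)
          then have A: "\<bar>A \<epsilon> u \<omega> - G u\<bar> \<le> \<delta>" if "u \<in> {0..t}" for u
            using that by (intro unif[OF A_mono[OF \<omega> \<epsilon>]])
          have "\<bar>forward_approx B ?\<phi> \<epsilon> u \<omega> - ?I u \<omega>\<bar> \<le> \<delta>" if "u \<in> {0..t}" for u
            using A[OF that] R[rule_format, OF that]
            unfolding err_eq[OF \<omega> \<epsilon> that] abs_le_iff by (simp add: field_simps)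
          then have "forward_error B ?\<phi> t ?I \<epsilon> \<omega> \<le> ereal \<delta>"
            unfolding forward_error_def by (intro SUP_least) simp
          then show False
            using E by (simp add: E_def flip: not_less)
        qed
      qed
    qed
    moreover have "((\<lambda>\<epsilon>. \<Sum>d\<in>D. 4 * C\<^sup>2 * d * \<epsilon> / (\<delta> / 2)\<^sup>2) \<longlongrightarrow> (\<Sum>d\<in>D. 4 * C\<^sup>2 * d * 0 / (\<delta> / 2)\<^sup>2)) (at_right 0)"
      using \<delta> by (intro tendsto_intros) auto
    ultimately have lim: "((\<lambda>\<epsilon>. prob (E \<epsilon> - (\<Union>d\<in>D. F \<epsilon> d)) + (\<Sum>d\<in>D. 4 * C\<^sup>2 * d * \<epsilon> / (\<delta> / 2)\<^sup>2)) \<longlongrightarrow> 0) (at_right 0)"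
      by (intro tendsto_add_zero) auto
    have bound: "prob (E \<epsilon>) \<le> prob (E \<epsilon> - (\<Union>d\<in>D. F \<epsilon> d)) + (\<Sum>d\<in>D. 4 * C\<^sup>2 * d * \<epsilon> / (\<delta> / 2)\<^sup>2)"
      if \<epsilon>: "0 < \<epsilon>" for \<epsilon>
    proof -
      have U: "(\<Union>d\<in>D. F \<epsilon> d) \<in> events"
        using \<epsilon> D(1) by (intro sets.finite_UN F_sets)
      have "prob (E \<epsilon>) \<le> prob ((E \<epsilon> - (\<Union>d\<in>D. F \<epsilon> d)) \<union> (\<Union>d\<in>D. F \<epsilon> d))"
        using E_sets[OF \<epsilon>] U by (intro finite_measure_mono) auto
      also have "\<dots> \<le> prob (E \<epsilon> - (\<Union>d\<in>D. F \<epsilon> d)) + prob (\<Union>d\<in>D. F \<epsilon> d)"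
        using E_sets[OF \<epsilon>] U by (intro measure_Un_le) auto
      also have "prob (\<Union>d\<in>D. F \<epsilon> d) \<le> (\<Sum>d\<in>D. prob (F \<epsilon> d))"
        using F_sets[OF \<epsilon>] D(1) by (intro measure_UNION_le) auto
      also have "\<dots> \<le> (\<Sum>d\<in>D. 4 * C\<^sup>2 * d * \<epsilon> / (\<delta> / 2)\<^sup>2)"
      proof (rule sum_mono)
        fix d assume "d \<in> D"
        then have d: "d \<in> {0..t}" using D(2) by auto
        then have "\<forall>s\<in>{0..d}. 0 \<le> g s \<and> g s \<le> C"
          using g_nonneg C by (force simp: abs_le_iff)
        then show "prob (F \<epsilon> d) \<le> 4 * C\<^sup>2 * d * \<epsilon> / (\<delta> / 2)\<^sup>2"
          unfolding F_def A_def G_def using \<epsilon> \<delta> d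
          by (intro prob_quadratic_variation_deviation_le contg_u) auto
      qed
      finally show ?thesis by simp
    qed
    have "((\<lambda>\<epsilon>. prob (E \<epsilon>)) \<longlongrightarrow> 0) (at_right 0)"
      using bound by (intro tendsto_sandwich[OF _ _ tendsto_const lim])
        (auto intro!: eventually_at_rightI[of 0 1])
    then show ?thesis
      by (simp add: E_def)
  qed
  moreover have "AE \<omega> in M. set_integrable lborel {0..t} (\<lambda>s. ?\<phi> s \<omega> * ((B (s + \<epsilon>) \<omega> - B s \<omega>) / \<epsilon>))"
    if "0 < \<epsilon>" for \<epsilon>
    by (intro AE_I2 borel_integrable_atLeastAtMost' cont_integrand that)
  ultimately show ?thesis
    unfolding is_forward_integral_def using I_meas err_meas by blast
qed

end

section \<open>Positive probability and the difference of the logarithmic utilities\<close>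

text \<open>Under a strictly positive density only Lebesgue null sets have probability 0, and a
  nondegenerate interval is not null.\<close>

lemma distributed_Icc_prob_pos:
  fixes X :: "'a \<Rightarrow> real"
  assumes "prob_space M" and X: "distributed M lborel X f"
    and f: "\<And>x. 0 < f x" and "a < b"
  shows "0 < measure M {\<omega> \<in> space M. X \<omega> \<in> {a..b}}"
proof -
  interpret prob_space M by fact
  have [measurable]: "X \<in> borel_measurable M" "f \<in> borel_measurable borel"
    using distributed_measurable[OF X] distributed_borel_measurable[OF X] by auto
  have "emeasure M (X -` {a..b} \<inter> space M) \<noteq> 0"
  proof
    assume "emeasure M (X -` {a..b} \<inter> space M) = 0"
    then have "(\<integral>\<^sup>+x. f x * indicator {a..b} x \<partial>lborel) = 0"
      using distributed_emeasure[OF X, of "{a..b}"] by simp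
    then have "AE x in lborel. f x * indicator {a..b} x = 0"
      by (subst (asm) nn_integral_0_iff_AE) auto
    then have "AE x in lborel. x \<notin> {a..b}"
      using f by (auto elim!: eventually_mono simp: indicator_def less_le split: if_splits)
    then have "{a..b} \<in> null_sets lborel"
      by (subst AE_iff_null_sets) auto
    then show False
      using assms(4) by (auto simp: null_sets_def)
  qed
  moreover have "X -` {a..b} \<inter> space M = {\<omega> \<in> space M. X \<omega> \<in> {a..b}}"
    by auto
  ultimately show ?thesis
    by (simp add: emeasure_eq_measure zero_less_measure_iff)
qed

lemma (in standard_brownian_motion) prob_increments_pos:
  assumes "0 \<le> s" "s < t" "t < u" and "a < b" "c < d"
  shows "0 < \<P>(\<omega> in M. B t \<omega> - B s \<omega> \<in> {a..b} \<and> B u \<omega> - B t \<omega> \<in> {c..d})"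
proof -
  have pos: "0 < \<P>(\<omega> in M. B w \<omega> - B v \<omega> \<in> {p..q})" if "0 \<le> v" "v < w" "p < q" for v w p q
    using that by (intro distributed_Icc_prob_pos[OF prob_space_axioms normal_increments])
      (auto intro: normal_density_pos)
  have "\<P>(\<omega> in M. B t \<omega> - B s \<omega> \<in> {a..b} \<and> B u \<omega> - B t \<omega> \<in> {c..d}) =
      \<P>(\<omega> in M. B t \<omega> - B s \<omega> \<in> {a..b}) * \<P>(\<omega> in M. B u \<omega> - B t \<omega> \<in> {c..d})"
    using assms by (intro prob_indep_random_variable[where N=borel] indep_increments) auto
  then show ?thesis
    using pos[of s t a b] pos[of t u c d] assms by simp
qed

text \<open>The honest wealth is a positive common factor, so the Ito integral cancels, whichever
  version \<open>ito_integral\<close> selects.\<close>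

lemma ln_insider_minus_ln_honest:
  "ln (insider_wealth M B r \<mu> \<sigma> T t \<omega>) - ln (honest_wealth M B r \<mu> \<sigma> t \<omega>) =
    forward_integral M B (\<lambda>s \<omega>. (B T \<omega> - B s \<omega>) / (T - s)) t \<omega> -
      (LINT s:{0..t}|lborel. (B T \<omega> - B s \<omega>)\<^sup>2 / (T - s)\<^sup>2) / 2"
  by (simp add: insider_wealth_def honest_wealth_def ln_mult)

text \<open>The time integrals in the forward integral and in the second exponent of the insider's wealth
  cancel, so only \<open>B T\<close> and \<open>B t\<close> remain.\<close>

lemma (in standard_brownian_motion) ln_insider_minus_ln_honest_AE:
  fixes r \<mu> \<sigma> :: "real \<Rightarrow> real"
  assumes "0 < t" "t < T"
  defines "\<Delta> \<equiv> \<lambda>\<omega>. ln (insider_wealth M B r \<mu> \<sigma> T t \<omega>) - ln (honest_wealth M B r \<mu> \<sigma> t \<omega>)"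
  shows "\<Delta> \<in> borel_measurable M"
    and "AE \<omega> in M. \<Delta> \<omega> =
      ((B T \<omega> - B 0 \<omega>)\<^sup>2 / T - (B T \<omega> - B t \<omega>)\<^sup>2 / (T - t) + ln (T / (T - t))) / 2"
proof -
  define g where "g s = 1 / (T - s)" for s
  define g' where "g' s = 1 / (T - s)\<^sup>2" for s
  let ?\<phi> = "\<lambda>s \<omega>. (B T \<omega> - B s \<omega>) / (T - s)"
  define L where "L \<omega> = (LINT s:{0..t}|lborel. (B T \<omega> - B s \<omega>)\<^sup>2 / (T - s)\<^sup>2)" for \<omega>
  have g: "(g has_real_derivative g' s) (at s within {0..t})" if "s \<in> {0..t}" for s
    unfolding g_def[abs_def] g'_def using that assms(2)
    by (auto intro!: derivative_eq_intros simp: power2_eq_square divide_simps)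
  have contg: "continuous_on {0..t} g" and contg': "continuous_on {0..t} g'"
    unfolding g_def g'_def using assms(2) by (auto intro!: continuous_intros)
  have "is_forward_integral M B (\<lambda>s \<omega>. g s * (B T \<omega> - B s \<omega>)) t (future_increment_integral T g g')"
    using assms(1,2) by (intro is_forward_integral_future_increment g contg') (auto simp: g_def)
  then have I: "is_forward_integral M B ?\<phi> t (future_increment_integral T g g')"
    by (simp add: g_def)
  \<comment> \<open>\<open>J\<close> is the version inside \<open>forward_integral\<close>. The
    explicit integral shows that the choice is meaningful, and uniqueness identifies both at time
    \<open>t\<close> almost surely.\<close>
  define J where "J = (SOME I. is_forward_integral M B ?\<phi> t I)"
  have J: "is_forward_integral M B ?\<phi> t J"
    unfolding J_def using I by (rule someI[where P="is_forward_integral M B ?\<phi> t"])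
  have \<Delta>: "\<Delta> \<omega> = J t \<omega> - L \<omega> / 2" for \<omega>
    unfolding \<Delta>_def ln_insider_minus_ln_honest forward_integral_def J_def L_def ..
  have [measurable]: "J t \<in> borel_measurable M"
    using J assms(1) by (simp add: is_forward_integral_def)
  have [measurable]: "L \<in> borel_measurable M"
    unfolding L_def
  proof (rule borel_measurable_set_integral_continuous)
    show "(\<lambda>\<omega>. (B T \<omega> - B s \<omega>)\<^sup>2 / (T - s)\<^sup>2) \<in> borel_measurable M" if "s \<in> {0..t}" for s
    proof -
      have [measurable]: "(\<lambda>\<omega>. B T \<omega> - B s \<omega>) \<in> borel_measurable M"
        using that assms(1,2) by (intro measurable_increment) auto
      show ?thesis by measurable
    qed
    show "continuous_on {0..t} (\<lambda>s. (B T \<omega> - B s \<omega>)\<^sup>2 / (T - s)\<^sup>2)" if "\<omega> \<in> space M" for \<omega>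
      using that assms(1,2) by (intro continuous_intros continuous_on_path) auto
  qed (use assms(1) in simp)
  show "\<Delta> \<in> borel_measurable M"
    unfolding \<Delta>[abs_def] by measurable
  have "(g has_integral (- ln (T - t) - - ln (T - 0))) {0..t}"
    unfolding g_def[abs_def] using assms(1,2)
    by (intro fundamental_theorem_of_calculus)
      (auto intro!: derivative_eq_intros simp flip: has_real_derivative_iff_has_vector_derivative)
  then have "(LINT s:{0..t}|lborel. g s) = ln (T / (T - t))"
    using set_borel_integral_eq_integral(2)[OF borel_integrable_atLeastAtMost'[OF contg]] assms(1,2)
    by (simp add: integral_unique ln_div)
  then have "future_increment_integral T g g' t \<omega> =
      ((B T \<omega> - B 0 \<omega>)\<^sup>2 / T - (B T \<omega> - B t \<omega>)\<^sup>2 / (T - t) + ln (T / (T - t))) / 2 + L \<omega> / 2" for \<omega>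
    by (simp add: future_increment_integral_def L_def) (simp add: g_def g'_def field_simps)
  then show "AE \<omega> in M. \<Delta> \<omega> =
      ((B T \<omega> - B 0 \<omega>)\<^sup>2 / T - (B T \<omega> - B t \<omega>)\<^sup>2 / (T - t) + ln (T / (T - t))) / 2"
    using is_forward_integral_unique[OF J I, of t] assms(1) by (auto simp: \<Delta>)
qed

theorem theorem4p1:
  fixes M :: "'a measure" and B :: "real \<Rightarrow> 'a \<Rightarrow> real"
    and r \<mu> \<sigma> :: "real \<Rightarrow> real" and T :: real
  assumes "T > 0"
    and "continuous_on {0..T} r" and "continuous_on {0..T} \<mu>" and "continuous_on {0..T} \<sigma>"
    and "\<forall>s\<in>{0..T}. \<sigma> s > 0"
    and "standard_brownian_motion M B"
  shows "\<forall>t. 0 < t \<and> t < T \<longrightarrow>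
    \<P>(\<omega> in M. ln (insider_wealth M B r \<mu> \<sigma> T t \<omega>) - ln (honest_wealth M B r \<mu> \<sigma> t \<omega>) < 0) > 0"
proof (intro allI impI, elim conjE)
  fix t assume t: "0 < t" "t < T"
  interpret standard_brownian_motion M B by fact
  note \<Delta> = ln_insider_minus_ln_honest_AE[OF t, of r \<mu> \<sigma>]
  \<comment> \<open>In \<open>neg\<close> below, \<open>x\<close> stands for B T - B 0 and
    \<open>y\<close> for B T - B t, so \<open>x - y\<close> is the increment over
    \<open>{0..t}\<close>. The two intervals force \<open>\<bar>x\<bar> \<le> h\<close>, hence x^2 /
    T <= 1, and \<open>y \<ge> a\<close>, hence y^2 / (T - t) >= c + 2; the total is then at most
    -1.\<close>
  define c where "c = ln (T / (T - t))"
  define h where "h = sqrt T"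
  define a where "a = sqrt ((T - t) * (c + 2))"
  have c: "0 < c"
    unfolding c_def using t by (intro ln_gt_zero) auto
  have neg: "x\<^sup>2 / T - y\<^sup>2 / (T - t) + c < 0" if "x - y \<in> {- a - h..- a}" "y \<in> {a..a + h}" for x y
  proof -
    have "0 \<le> a" "0 \<le> h"
      using c t by (auto simp: a_def h_def)
    have "\<bar>x\<bar> \<le> h"
      using that by auto
    then have "x\<^sup>2 \<le> h\<^sup>2"
      using abs_le_square_iff[of x h] \<open>0 \<le> h\<close> by simp
    then have "x\<^sup>2 / T \<le> 1"
      using t by (simp add: h_def)
    moreover have "a\<^sup>2 \<le> y\<^sup>2"
      using that \<open>0 \<le> a\<close> by (intro power_mono) auto
    then have "c + 2 \<le> y\<^sup>2 / (T - t)"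
      using c t by (simp add: a_def pos_le_divide_eq mult.commute)
    ultimately show ?thesis by linarith
  qed
  have "0 < \<P>(\<omega> in M. B t \<omega> - B 0 \<omega> \<in> {- a - h..- a} \<and> B T \<omega> - B t \<omega> \<in> {a..a + h})"
    using t by (intro prob_increments_pos) (auto simp: h_def)
  also have "\<dots> \<le> \<P>(\<omega> in M. ln (insider_wealth M B r \<mu> \<sigma> T t \<omega>) - ln (honest_wealth M B r \<mu> \<sigma> t \<omega>) < 0)"
  \<comment> \<open>The inclusion of events holds only up to a null set, since the closed formula
    for the difference is an almost sure statement.\<close>
  proof (rule finite_measure_mono_AE)
    show "AE \<omega> in M. \<omega> \<in> {\<omega> \<in> space M. B t \<omega> - B 0 \<omega> \<in> {- a - h..- a} \<and> B T \<omega> - B t \<omega> \<in> {a..a + h}} \<longrightarrow>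
        \<omega> \<in> {\<omega> \<in> space M. ln (insider_wealth M B r \<mu> \<sigma> T t \<omega>) - ln (honest_wealth M B r \<mu> \<sigma> t \<omega>) < 0}"
      using \<Delta>(2)
    proof eventually_elim
      case (elim \<omega>)
      then show ?case
        using neg[of "B T \<omega> - B 0 \<omega>" "B T \<omega> - B t \<omega>"] by (auto simp: c_def)
    qed
    show "{\<omega> \<in> space M. ln (insider_wealth M B r \<mu> \<sigma> T t \<omega>) - ln (honest_wealth M B r \<mu> \<sigma> t \<omega>) < 0} \<in> events"
      using \<Delta>(1) by measurable
  qed
  finally show "0 < \<P>(\<omega> in M. ln (insider_wealth M B r \<mu> \<sigma> T t \<omega>) - ln (honest_wealth M B r \<mu> \<sigma> t \<omega>) < 0)" .
qed

end
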